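(* Let $C=\{(0,0),(0,1),(0,2),(0,3)\}$ and $S_9=\{(1,1),(1,2),(3,1),(3,2)\}$, $S_{10}=\{(1,2),(1,3),(3,2),(3,3)\}$, $S_{11}=\{(1,1),(1,3),(2,1),(2,3)\}$, $S_{12}=\{(2,1),(2,3),(3,1),(3,3)\}$, $S_{13}=\{(1,1),(1,2),(1,3),(3,2)\}$, $S_{14}=\{(1,2),(3,1),(3,2),(3,3)\}$, $S_{15}=\{(1,1),(2,1),(2,3),(3,1)\}$, $S_{16}=\{(1,3),(2,1),(2,3),(3,3)\}$, $S_{17}=\{(2,1),(2,2),(3,1),(3,2)\}$, $S_{18}=\{(1,2),(1,3),(2,2),(2,3)\}$. For $9\le j\le 18$ let $X_j=C\cup S_j$ and $Y_j=\{(y,x):(x,y)\in X_j\}$. Then the twenty pairs $\{(123,R),(132,R)\}$ with $R\in\{X_9,\dots,X_{18},Y_9,\dots,Y_{18}\}$ all have the same joint distribution. Moreover, for each such $R$, every $n\ge 2$ and all nonnegative integers $k,\ell$, the number $T_{n,k,\ell}$ of $n$-permutations with exactly $k$ occurrences of $(123,R)$ and $\ell$ occurrences of $(132,R)$ satisfies $$T_{n,k,\ell}=\begin{cases}(n-1)!\,\binom{k+\ell}{k}\sum_{i=2}^{n-1}\frac{1}{i!}\,c(i-1,k+\ell), & k\ne 0\text{ or }\ell\neq 0,\\ 2(n-1)!, & k=\ell=0.\end{cases}$$ Equivalently, the generating function $T_n(x,y)=\sum_{k=0}^{n-2}\sum_{\ell=0}^{n-2}T_{n,k,\ell}x^ky^\ell$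 is $$T_n(x,y)=(n-1)!\sum_{k=0}^{n-1}\sum_{\ell=0}^{n-1}\sum_{i=2}^{n-1}\frac{1}{i!}\binom{k+\ell}{k}c(i-1,k+\ell)\,x^ky^\ell+2(n-1)!.$$
   Context: $S_n$ is the set of permutations $\pi=\pi_1\cdots\pi_n$ of $\{1,\dots,n\}$ ($n$-permutations). A mesh pattern of length $k$ is a pair $(\tau,R)$ with $\tau\in S_k$ and $R\subseteq\{0,\dots,k\}\times\{0,\dots,k\}$ (the set of shaded boxes; box $(a,b)$ is the unit square with lower-left corner $(a,b)$). An occurrence of $(\tau,R)$ in $\pi\in S_n$ is a subsequence $\pi_{i_1}\cdots\pi_{i_k}$, $i_1<\dots<i_k$, order-isomorphic to $\tau$, such that, with $i_0=0$, $i_{k+1}=n+1$, with $v_1<\dots<v_k$ the values $\pi_{i_1},\dots,\pi_{i_k}$ in increasing order, and $v_0=0$, $v_{k+1}=n+1$, for each $(a,b)\in R$ there is no index $m$ with $i_a<m<i_{a+1}$ and $v_b<\pi_m<v_{b+1}$. The joint distribution of a pair $\{(123,R),(132,R)\}$ is the family of numbers $T_{n,k,\ell}$ of $\pi\in S_n$ with exactly $k$ occurrences of $(123,R)$ and $\ell$ occurrences of $(132,R)$; two pairs have the same joint distribution if these numbers agree for all $n,k,\ell$. The unsigned Stirling numbers of the first kind $c(n,k)$ are defined by $c(0,0)=1$, $c(n,k)=0$ if $n<k$ or $k=0$ (except $c(0,0)=1$), and $c(n,k)=(n-1)c(n-1,k)+c(n-1,k-1)$ otherwise. An empty sum is $0$.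 *)

theory Defs
  imports
    "HOL-Combinatorics.Permutations"
    "HOL-Combinatorics.Stirling"
    "HOL-Computational_Algebra.Polynomial"
begin

text \<open>
  An \<open>n\<close>-permutation is a function \<open>\<pi>\<close> with \<open>\<pi> permutes {1..n}\<close>, where \<open>\<pi> m\<close> is its \<open>m\<close>-th letter.
  A mesh pattern of length \<open>k\<close> is a pair \<open>(\<tau>, R)\<close> with \<open>\<tau> permutes {1..k}\<close> and
  \<open>R \<subseteq> {0..k} \<times> {0..k}\<close>.
\<close>

type_synonym mesh_pattern = "(nat \<Rightarrow> nat) \<times> (nat \<times> nat) set"

text \<open>
  A subsequence is identified with its set \<open>I\<close> of positions. The lists \<open>i\<close> and \<open>v\<close> are
  \<open>i\<^sub>0, \<dots>, i\<^bsub>k+1\<^esub>\<close> and \<open>v\<^sub>0, \<dots>, v\<^bsub>k+1\<^esub>\<close>, including the boundary entries \<open>0\<close> and \<open>n + 1\<close>,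
  so list indices agree with the mathematical subscripts.
\<close>

definition mesh_occurrence ::
    "nat \<Rightarrow> mesh_pattern \<Rightarrow> nat \<Rightarrow> (nat \<Rightarrow> nat) \<Rightarrow> nat set \<Rightarrow> bool" where
  "mesh_occurrence k p n \<pi> I \<longleftrightarrow>
     I \<subseteq> {1..n} \<and> card I = k \<and>
     (let \<tau> = fst p; R = snd p;
          i = 0 # sorted_list_of_set I @ [n + 1];
          v = 0 # sorted_list_of_set (\<pi> ` I) @ [n + 1]
      in (\<forall>a\<in>{1..k}. \<forall>b\<in>{1..k}. \<pi> (i ! a) < \<pi> (i ! b) \<longleftrightarrow> \<tau> a < \<tau> b) \<and>
         (\<forall>(a, b)\<in>R. \<not> (\<exists>m. i ! a < m \<and> m < i ! (a + 1) \<and> v ! b < \<pi> m \<and> \<pi> m < v ! (b + 1))))"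

definition mesh_count :: "nat \<Rightarrow> mesh_pattern \<Rightarrow> nat \<Rightarrow> (nat \<Rightarrow> nat) \<Rightarrow> nat" where
  "mesh_count k p n \<pi> = card {I. mesh_occurrence k p n \<pi> I}"

definition pattern123 :: "(nat \<times> nat) set \<Rightarrow> mesh_pattern" where
  "pattern123 R = (id, R)"

definition pattern132 :: "(nat \<times> nat) set \<Rightarrow> mesh_pattern" where
  "pattern132 R = (transpose 2 3, R)"

definition joint_number :: "(nat \<times> nat) set \<Rightarrow> nat \<Rightarrow> nat \<Rightarrow> nat \<Rightarrow> nat" where
  "joint_number R n k l =
     card {\<pi>. \<pi> permutes {1..n} \<and>
              mesh_count 3 (pattern123 R) n \<pi> = k \<and> mesh_count 3 (pattern132 R) n \<pi> = l}"

definition same_joint_distribution :: "(nat \<times> nat) set \<Rightarrow> (nat \<times> nat) set \<Rightarrow> bool" where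
  "same_joint_distribution R R' \<longleftrightarrow> (\<forall>n k l. joint_number R n k l = joint_number R' n k l)"

text \<open>
  Bivariate polynomials are polynomials in \<open>x\<close> over polynomials in \<open>y\<close>:
  \<open>monom (monom c l) k\<close> is \<open>c x\<^sup>k y\<^sup>l\<close>.
\<close>

definition joint_gf :: "(nat \<times> nat) set \<Rightarrow> nat \<Rightarrow> real poly poly" where
  "joint_gf R n = (\<Sum>k=0..n-2. \<Sum>l=0..n-2. monom (monom (real (joint_number R n k l)) l) k)"

definition C_boxes :: "(nat \<times> nat) set" where
  "C_boxes = {(0,0), (0,1), (0,2), (0,3)}"

text \<open>\<open>S_boxes\<close> is only meaningful for \<open>9 \<le> j \<le> 18\<close>; the list starts with \<open>S\<^sub>9\<close>.\<close>

definition S_boxes :: "nat \<Rightarrow> (nat \<times> nat) set" where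
  "S_boxes j =
    [{(1,1), (1,2), (3,1), (3,2)},
     {(1,2), (1,3), (3,2), (3,3)},
     {(1,1), (1,3), (2,1), (2,3)},
     {(2,1), (2,3), (3,1), (3,3)},
     {(1,1), (1,2), (1,3), (3,2)},
     {(1,2), (3,1), (3,2), (3,3)},
     {(1,1), (2,1), (2,3), (3,1)},
     {(1,3), (2,1), (2,3), (3,3)},
     {(2,1), (2,2), (3,1), (3,2)},
     {(1,2), (1,3), (2,2), (2,3)}] ! (j - 9)"

definition X_boxes :: "nat \<Rightarrow> (nat \<times> nat) set" where
  "X_boxes j = C_boxes \<union> S_boxes j"

definition Y_boxes :: "nat \<Rightarrow> (nat \<times> nat) set" where
  "Y_boxes j = {(y, x). (x, y) \<in> X_boxes j}"

definition shadings :: "(nat \<times> nat) set set" where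
  "shadings = X_boxes ` {9..18} \<union> Y_boxes ` {9..18}"

end

theory Submission imports Defs begin

text \<open>
  The shaded first column forces the first letter \<open>a\<close> of a permutation to play the role of \<open>1\<close>
  in every occurrence. Letters below \<open>a\<close> are then irrelevant, and the points above \<open>a\<close> form a
  permutation diagram in which one counts ascending (for 123) and descending (for 132) pairs
  avoiding the boxes \<open>S\<^sub>j\<close> shifted by \<open>(-1,-1)\<close>. For each of the ten shifted sets the generating
  function of these pairs over diagrams of size \<open>m \<ge> 1\<close> is the rising factorial
  \<open>(x+y)(x+y+1)\<cdots>(x+y+m-2)\<close>: for \<open>S\<^sub>1\<^sub>2\<close> and \<open>S\<^sub>1\<^sub>7\<close> exactly one height of the leftmost point
  creates an ascending pair and exactly one other a descending pair; for \<open>S\<^sub>1\<^sub>3\<close> one splits by the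
  leftmost height and uses Vandermonde's identity; mirror image and transposition give the rest.
  Inverting permutations transposes the shading, which settles the \<open>Y\<^sub>j\<close>. Expanding rising factorials
  in Stirling numbers and summing over \<open>a\<close> yields the formula.
\<close>

subsection \<open>Permutation diagrams\<close>

text \<open>Deleting a letter from a permutation of \<open>{1..n}\<close> does not leave such a
  permutation. Diagrams are therefore point sets with arbitrary column and row sets, namely the
  graphs of bijections. Deleting a point is then set difference without renumbering, transposing is
  \<open>converse\<close>, relabelling columns is an image, and every induction stays inside one
  class of objects.

  The shape of the formula has simple causes. With \<open>m\<close> letters above the first one, the
  \<open>n - 1 - m\<close> lower letters can be inserted anywhere, which gives the factor
  \<open>(n - 1)! / m!\<close>. The polynomial depends on \<open>x + y\<close> only, so the
  coefficient of each power \<open>(x + y)^s\<close> is split by the binomial theorem; hence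
  \<open>k + l choose k\<close>. Diagrams of sizes 0 and 1 contain no pair and have weight 1, and
  every larger total weight has constant term 0. So \<open>2 (n - 1)!\<close> counts the
  permutations that begin with \<open>n\<close> or \<open>n - 1\<close>.\<close>

definition diagrams :: "nat set \<Rightarrow> nat set \<Rightarrow> (nat \<times> nat) set set" where
  "diagrams A V = {P. inj_on fst P \<and> inj_on snd P \<and> fst ` P = A \<and> snd ` P = V}"

lemma diagrams_subset: "P \<in> diagrams A V \<Longrightarrow> P \<subseteq> A \<times> V"
  by (force simp: diagrams_def)

lemma diagrams_imp_finite: "P \<in> diagrams A V \<Longrightarrow> finite A \<Longrightarrow> finite P"
  by (auto simp: diagrams_def dest: finite_imageD)

lemma finite_diagrams: "finite A \<Longrightarrow> finite V \<Longrightarrow> finite (diagrams A V)"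
  by (rule finite_subset[of _ "Pow (A \<times> V)"]) (use diagrams_subset in auto)

lemma diagrams_empty [simp]: "diagrams {} {} = {{}}"
  by (auto simp: diagrams_def)

lemma diagrams_converse_iff: "P\<inverse> \<in> diagrams A V \<longleftrightarrow> P \<in> diagrams V A"
proof -
  have P: "P\<inverse> = prod.swap ` P"
    by force
  have "inj_on fst (prod.swap ` P) = inj_on snd P" "inj_on snd (prod.swap ` P) = inj_on fst P"
    by (fastforce simp: inj_on_def)+
  then show ?thesis
    unfolding diagrams_def P by (auto simp: image_image)
qed

lemma sum_diagrams_converse:
  "(\<Sum>P\<in>diagrams A V. F P) = (\<Sum>P\<in>diagrams V A. F (P\<inverse>))"
  by (rule sum.reindex_bij_witness[of _ converse converse]) (auto simp: diagrams_converse_iff)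

lemma diagrams_insert:
  assumes "P \<in> diagrams (A - {c}) (V - {v})" "c \<in> A" "v \<in> V"
  shows "insert (c, v) P \<in> diagrams A V"
proof -
  from assms(1) have P: "inj_on fst P" "inj_on snd P" "fst ` P = A - {c}" "snd ` P = V - {v}"
    by (auto simp: diagrams_def)
  then have "P - {(c, v)} = P" by force
  with P assms(2,3) show ?thesis
    by (auto simp: diagrams_def)
qed

lemma diagrams_remove:
  assumes "P \<in> diagrams A V" "(c, v) \<in> P"
  shows "P - {(c, v)} \<in> diagrams (A - {c}) (V - {v})"
proof -
  have P: "inj_on fst P" "inj_on snd P" "fst ` P = A" "snd ` P = V"
    using assms(1) by (auto simp: diagrams_def)
  have "fst ` (P - {(c, v)}) = A - {c}" "snd ` (P - {(c, v)}) = V - {v}"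
    using inj_on_image_set_diff[OF P(1), of P "{(c, v)}"]
      inj_on_image_set_diff[OF P(2), of P "{(c, v)}"] P assms(2) by auto
  with P show ?thesis
    by (auto simp: diagrams_def intro: inj_on_subset)
qed

text \<open>Every diagram has exactly one point in column \<open>c\<close>. Deleting it and
  remembering its height \<open>v\<close> is a bijection, the analogue of expanding a determinant
  along a column; all recursions below rest on it.\<close>

lemma sum_diagrams_column:
  assumes fin: "finite A" "finite V" and c: "c \<in> A"
  shows "(\<Sum>P\<in>diagrams A V. F P) =
    (\<Sum>v\<in>V. \<Sum>P\<in>diagrams (A - {c}) (V - {v}). F (insert (c, v) P))"
proof -
  have notin: "(c, v) \<notin> P" if "P \<in> diagrams (A - {c}) (V - {v})" for P v
    using diagrams_subset[OF that] by auto
  have ex: "\<exists>v. (c, v) \<in> P" if "P \<in> diagrams A V" for P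
    using that c by (auto simp: diagrams_def)
  have uniq: "v = w" if "P \<in> diagrams A V" "(c, v) \<in> P" "(c, w) \<in> P" for P v w
    using that by (force simp: diagrams_def inj_on_def)
  have "(\<Sum>v\<in>V. \<Sum>P\<in>diagrams (A - {c}) (V - {v}). F (insert (c, v) P)) =
    (\<Sum>(v, P)\<in>(SIGMA v:V. diagrams (A - {c}) (V - {v})). F (insert (c, v) P))"
    using fin by (subst sum.Sigma) (auto simp: finite_diagrams)
  also have "\<dots> = (\<Sum>P\<in>diagrams A V. F P)"
  proof (rule sum.reindex_bij_witness[of _ "\<lambda>P. (THE v. (c, v) \<in> P, P - {(c, THE v. (c, v) \<in> P)})"
        "\<lambda>(v, P). insert (c, v) P"], goal_cases)
    case (1 z)
    then obtain v P where z: "z = (v, P)" "v \<in> V" "P \<in> diagrams (A - {c}) (V - {v})" by auto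
    have "(THE w. (c, w) \<in> insert (c, v) P) = v"
      using uniq[OF diagrams_insert[OF z(3) c z(2)]] by blast
    then show ?case using notin[OF z(3)] z by simp
  next
    case (2 z)
    then show ?case using c by (auto intro: diagrams_insert)
  next
    case (3 P)
    obtain v where v: "(c, v) \<in> P" using ex[OF 3] by auto
    then have "(THE w. (c, w) \<in> P) = v" using uniq[OF 3] by blast
    with v show ?case by auto
  next
    case (4 P)
    obtain v where v: "(c, v) \<in> P" using ex[OF 4] by auto
    then have "(THE w. (c, w) \<in> P) = v" using uniq[OF 4] by blast
    moreover have "v \<in> V" using diagrams_subset[OF 4] v by auto
    ultimately show ?case using diagrams_remove[OF 4 v] by auto
  next
    case (5 z)
    then show ?case by auto
  qed
  finally show ?thesis ..
qed

lemma diagrams_singleton: "diagrams {a} {v} = {{(a, v)}}"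
proof (intro equalityI subsetI)
  fix P assume P: "P \<in> diagrams {a} {v}"
  then have "P \<noteq> {}" by (auto simp: diagrams_def)
  with diagrams_subset[OF P] show "P \<in> {{(a, v)}}" by auto
qed (auto simp: diagrams_def)

text \<open>Rows outside \<open>H\<close> can be placed freely: each of the
  \<open>(|A| - |H|)!\<close> orders of each choice of columns contributes the same sum.\<close>

lemma sum_diagrams_filter:
  fixes F :: "(nat \<times> nat) set \<Rightarrow> 'a :: comm_semiring_1"
  assumes "finite L" "finite H" "L \<inter> H = {}" "finite A" "card A = card L + card H"
    and W: "\<And>A'. finite A' \<Longrightarrow> card A' = card H \<Longrightarrow> (\<Sum>P\<in>diagrams A' H. F P) = W"
  shows "of_nat (fact (card H)) * (\<Sum>P\<in>diagrams A (L \<union> H). F {z \<in> P. snd z \<in> H}) =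
    of_nat (fact (card A)) * W"
  using assms(1,3-5)
proof (induction L arbitrary: A rule: finite_induct)
  case empty
  have "(\<Sum>P\<in>diagrams A H. F {z \<in> P. snd z \<in> H}) = (\<Sum>P\<in>diagrams A H. F P)"
  proof (rule sum.cong)
    fix P assume "P \<in> diagrams A H"
    then have "{z \<in> P. snd z \<in> H} = P" using diagrams_subset by fastforce
    then show "F {z \<in> P. snd z \<in> H} = F P" by simp
  qed simp
  then show ?case using W[of A] empty by simp
next
  case (insert v L)
  have v: "v \<notin> H" and "L \<inter> H = {}" using insert.prems by auto
  have eq: "insert v L \<union> H - {v} = L \<union> H" using v insert.hyps by auto
  \<comment> \<open>Transposition makes row \<open>v\<close> a column, so that
    \<open>sum_diagrams_column\<close> can delete its point; since \<open>v\<close> is outside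
    \<open>H\<close>, the filtered set does not change.\<close>
  have "(\<Sum>P\<in>diagrams A (insert v L \<union> H). F {z \<in> P. snd z \<in> H})
    = (\<Sum>P\<in>diagrams (insert v L \<union> H) A. F {z \<in> P\<inverse>. snd z \<in> H})"
    by (rule sum_diagrams_converse)
  also have "\<dots> = (\<Sum>c\<in>A. \<Sum>P\<in>diagrams (L \<union> H) (A - {c}).
       F {z \<in> (insert (v, c) P)\<inverse>. snd z \<in> H})"
    using insert.hyps insert.prems \<open>finite H\<close>
    by (subst sum_diagrams_column[of _ _ v]) (simp_all only: eq, auto)
  also have "\<dots> = (\<Sum>c\<in>A. \<Sum>P\<in>diagrams (A - {c}) (L \<union> H). F {z \<in> P. snd z \<in> H})"
  proof (rule sum.cong[OF refl])
    fix c assume "c \<in> A"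
    have "{z \<in> (insert (v, c) P)\<inverse>. snd z \<in> H} = {z \<in> P\<inverse>. snd z \<in> H}" for P
      using v by auto
    then show "(\<Sum>P\<in>diagrams (L \<union> H) (A - {c}). F {z \<in> (insert (v, c) P)\<inverse>. snd z \<in> H})
       = (\<Sum>P\<in>diagrams (A - {c}) (L \<union> H). F {z \<in> P. snd z \<in> H})"
      by (subst (2) sum_diagrams_converse) simp
  qed
  finally have *: "(\<Sum>P\<in>diagrams A (insert v L \<union> H). F {z \<in> P. snd z \<in> H})
    = (\<Sum>c\<in>A. \<Sum>P\<in>diagrams (A - {c}) (L \<union> H). F {z \<in> P. snd z \<in> H})" .
  have "of_nat (fact (card H)) * (\<Sum>P\<in>diagrams A (insert v L \<union> H). F {z \<in> P. snd z \<in> H})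
    = (\<Sum>c\<in>A. of_nat (fact (card H)) * (\<Sum>P\<in>diagrams (A - {c}) (L \<union> H). F {z \<in> P. snd z \<in> H}))"
    by (simp only: * sum_distrib_left)
  also have "\<dots> = (\<Sum>c\<in>A. of_nat (fact (card A - 1)) * W)"
  proof (rule sum.cong[OF refl])
    fix c assume c: "c \<in> A"
    show "of_nat (fact (card H)) * (\<Sum>P\<in>diagrams (A - {c}) (L \<union> H). F {z \<in> P. snd z \<in> H})
      = of_nat (fact (card A - 1)) * W"
      using insert.IH[of "A - {c}"] c insert.prems insert.hyps \<open>L \<inter> H = {}\<close> by simp
  qed
  also have "\<dots> = of_nat (card A * fact (card A - 1)) * W"
    by (simp add: mult.assoc)
  also have "card A * fact (card A - 1) = fact (card A)"
    using insert.prems insert.hyps by (simp add: fact_reduce[of "card A"])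
  finally show ?case .
qed

subsection \<open>Pairs avoiding boxes\<close>

text \<open>Every index other than 0 and 1 acts as 2. The inequalities are strict, so the two points
  of a pair never block the pair themselves.\<close>

definition gap :: "nat \<Rightarrow> nat \<Rightarrow> nat \<Rightarrow> nat \<Rightarrow> bool" where
  "gap a u v m \<longleftrightarrow> (if a = 0 then m < u else if a = 1 then u < m \<and> m < v else v < m)"

text \<open>Here \<open>s\<close> is meant to be the left point and \<open>t\<close> the right one.
  Taking \<open>min\<close> and \<open>max\<close> of the heights lets one predicate serve ascending
  and descending pairs, which share the shading.\<close>

definition empty_boxes ::
    "(nat \<times> nat) set \<Rightarrow> (nat \<times> nat) set \<Rightarrow> nat \<times> nat \<Rightarrow> nat \<times> nat \<Rightarrow> bool" where
  "empty_boxes S P s t \<longleftrightarrow> (\<forall>(a, b)\<in>S. \<forall>z\<in>P.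
     \<not> (gap a (fst s) (fst t) (fst z) \<and>
        gap b (min (snd s) (snd t)) (max (snd s) (snd t)) (snd z)))"

definition ascs :: "(nat \<times> nat) set \<Rightarrow> (nat \<times> nat) set \<Rightarrow> ((nat \<times> nat) \<times> (nat \<times> nat)) set" where
  "ascs S P = {(s, t). s \<in> P \<and> t \<in> P \<and> fst s < fst t \<and> snd s < snd t \<and> empty_boxes S P s t}"

definition descs :: "(nat \<times> nat) set \<Rightarrow> (nat \<times> nat) set \<Rightarrow> ((nat \<times> nat) \<times> (nat \<times> nat)) set" where
  "descs S P = {(s, t). s \<in> P \<and> t \<in> P \<and> fst s < fst t \<and> snd t < snd s \<and> empty_boxes S P s t}"

definition weight :: "'a \<Rightarrow> 'a \<Rightarrow> (nat \<times> nat) set \<Rightarrow> (nat \<times> nat) set \<Rightarrow> 'a :: comm_ring_1" where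
  "weight x y S P = x ^ card (ascs S P) * y ^ card (descs S P)"

lemma finite_ascs: "finite P \<Longrightarrow> finite (ascs S P)"
  by (rule finite_subset[of _ "P \<times> P"]) (auto simp: ascs_def)

lemma finite_descs: "finite P \<Longrightarrow> finite (descs S P)"
  by (rule finite_subset[of _ "P \<times> P"]) (auto simp: descs_def)

lemma empty_boxes_iff:
  "empty_boxes S P (a, b) (c, d) \<longleftrightarrow> (\<forall>i j p q. (i, j) \<in> S \<longrightarrow> (p, q) \<in> P \<longrightarrow>
     \<not> (gap i a c p \<and> gap j (min b d) (max b d) q))"
  by (fastforce simp: empty_boxes_def)

text \<open>Transposition keeps the left-to-right order of an ascending pair but reverses that of a
  descending one, whose lower point then comes first; hence the two argument orders.\<close>

lemma empty_boxes_converse: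
  assumes "a < c"
  shows "b < d \<Longrightarrow> empty_boxes S (P\<inverse>) (b, a) (d, c) \<longleftrightarrow> empty_boxes (S\<inverse>) P (a, b) (c, d)"
    and "d < b \<Longrightarrow> empty_boxes S (P\<inverse>) (d, c) (b, a) \<longleftrightarrow> empty_boxes (S\<inverse>) P (a, b) (c, d)"
  using assms by (simp add: empty_boxes_iff; blast)+

lemma card_ascs_converse: "card (ascs S (P\<inverse>)) = card (ascs (S\<inverse>) P)"
  by (rule bij_betw_same_card[of "\<lambda>(s, t). (prod.swap s, prod.swap t)"],
      rule bij_betw_byWitness[of _ "\<lambda>(s, t). (prod.swap s, prod.swap t)"])
    (auto simp: ascs_def empty_boxes_converse)

lemma card_descs_converse: "card (descs S (P\<inverse>)) = card (descs (S\<inverse>) P)"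
  by (rule bij_betw_same_card[of "\<lambda>(s, t). (prod.swap t, prod.swap s)"],
      rule bij_betw_byWitness[of _ "\<lambda>(s, t). (prod.swap t, prod.swap s)"])
    (auto simp: descs_def empty_boxes_converse)

lemma weight_converse: "weight x y S (P\<inverse>) = weight x y (S\<inverse>) P"
  by (simp add: weight_def card_ascs_converse card_descs_converse)

subsection \<open>Generating functions of pairs in diagrams\<close>

text \<open>\<open>pochhammer\<close> is the rising factorial. Quantifying over all column and row
  sets lets the property pass to transposes, and quantifying over \<open>x\<close> and
  \<open>y\<close> lets the two be exchanged under reflection. The ring is the one in which
  coefficients are read off at the end.\<close>

definition rising_weights :: "(nat \<times> nat) set \<Rightarrow> bool" where
  "rising_weights S \<longleftrightarrow> (\<forall>A V (x :: real poly poly) y.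
     finite A \<and> finite V \<and> card A = card V \<and> V \<noteq> {} \<longrightarrow>
     (\<Sum>P\<in>diagrams A V. weight x y S P) = pochhammer (x + y) (card V - 1))"

lemma rising_weights_converse:
  assumes "rising_weights S" shows "rising_weights (S\<inverse>)"
  unfolding rising_weights_def
proof (intro allI impI, elim conjE)
  fix A V :: "nat set" and x y :: "real poly poly"
  assume *: "finite A" "finite V" "card A = card V" "V \<noteq> {}"
  have "A \<noteq> {}" using * by auto
  with assms * show "(\<Sum>P\<in>diagrams A V. weight x y (S\<inverse>) P) = pochhammer (x + y) (card V - 1)"
    by (subst sum_diagrams_converse) (simp add: weight_converse rising_weights_def)
qed

section \<open>Relabelling columns and reflection in a vertical line\<close>

lemma diagrams_image:
  assumes "P \<in> diagrams A V" "inj_on f A"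
  shows "map_prod f id ` P \<in> diagrams (f ` A) V"
proof -
  have P: "inj_on fst P" "inj_on snd P" "fst ` P = A" "snd ` P = V"
    using assms(1) by (auto simp: diagrams_def)
  have "inj_on (f \<circ> fst) P"
    using P assms(2) by (simp add: comp_inj_on)
  then have "inj_on fst (map_prod f id ` P)"
    by (intro inj_on_imageI) (simp add: comp_def)
  moreover have "inj_on snd (map_prod f id ` P)"
    using P(2) by (intro inj_on_imageI) (simp add: comp_def)
  moreover have "fst ` map_prod f id ` P = f ` A" "snd ` map_prod f id ` P = V"
    unfolding P(3,4)[symmetric] image_image by simp_all
  ultimately show ?thesis
    by (simp add: diagrams_def)
qed

lemma sum_diagrams_image:
  assumes f: "inj_on f A"
  shows "(\<Sum>P\<in>diagrams (f ` A) V. F P) = (\<Sum>P\<in>diagrams A V. F (map_prod f id ` P))"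
proof -
  let ?g = "inv_into A f"
  have cancel: "map_prod h id ` map_prod k id ` P = P"
    if "\<And>a. a \<in> B \<Longrightarrow> h (k a) = a" "P \<in> diagrams B V" for h k :: "nat \<Rightarrow> nat" and B P
  proof -
    have "map_prod h id (map_prod k id z) = z" if "z \<in> P" for z
    proof -
      have "fst z \<in> B" using \<open>P \<in> diagrams B V\<close> \<open>z \<in> P\<close> by (auto simp: diagrams_def)
      then show ?thesis using \<open>\<And>a. a \<in> B \<Longrightarrow> h (k a) = a\<close> by (simp add: prod_eq_iff)
    qed
    then show ?thesis by (simp add: image_image)
  qed
  have "inj_on ?g (f ` A)" "?g ` f ` A = A"
    using f by (simp_all add: inj_on_inv_into)
  then have "map_prod ?g id ` P \<in> diagrams A V" if "P \<in> diagrams (f ` A) V" for P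
    using diagrams_image[OF that, of ?g] by simp
  moreover have "map_prod f id ` map_prod ?g id ` P = P" if "P \<in> diagrams (f ` A) V" for P
    by (rule cancel[OF _ that]) (rule f_inv_into_f)
  moreover have "map_prod ?g id ` map_prod f id ` P = P" if "P \<in> diagrams A V" for P
    by (rule cancel[OF _ that]) (rule inv_into_f_f[OF f])
  moreover note diagrams_image[OF _ f]
  ultimately show ?thesis
    by (intro sum.reindex_bij_witness[of _ "(`) (map_prod f id)" "(`) (map_prod ?g id)"]) simp_all
qed

lemma inj_on_antimono:
  fixes f :: "nat \<Rightarrow> nat"
  assumes "\<And>i j. i \<in> A \<Longrightarrow> j \<in> A \<Longrightarrow> f i < f j \<longleftrightarrow> j < i"
  shows "inj_on f A"
proof (rule inj_onI)
  fix i j assume "i \<in> A" "j \<in> A" "f i = f j"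
  then show "i = j" using assms[of i j] assms[of j i] by simp
qed

lemma gap_antimono:
  assumes "\<And>i j. i \<in> A \<Longrightarrow> j \<in> A \<Longrightarrow> f i < f j \<longleftrightarrow> j < i" "u \<in> A" "v \<in> A" "m \<in> A" "a \<le> 2"
  shows "gap (2 - a) (f v) (f u) (f m) \<longleftrightarrow> gap a u v m"
  using assms by (auto simp: gap_def)

text \<open>Subtraction truncates, so this is a reflection only for column indices at most 2, which
  the lemmas below demand.\<close>

definition mirror :: "(nat \<times> nat) set \<Rightarrow> (nat \<times> nat) set" where
  "mirror S = map_prod (\<lambda>a. 2 - a) id ` S"

lemma empty_boxes_mirror:
  assumes f: "\<And>i j. i \<in> A \<Longrightarrow> j \<in> A \<Longrightarrow> f i < f j \<longleftrightarrow> j < i" and S: "\<forall>(a, b)\<in>S. a \<le> 2"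
    and P: "fst ` P \<subseteq> A" "s \<in> P" "t \<in> P"
  shows "empty_boxes (mirror S) (map_prod f id ` P) (map_prod f id t) (map_prod f id s) \<longleftrightarrow>
    empty_boxes S P s t"
proof -
  have "gap (2 - a) (f (fst t)) (f (fst s)) (f (fst z)) \<longleftrightarrow> gap a (fst s) (fst t) (fst z)"
    if "(a, b) \<in> S" "z \<in> P" for a b z
    using that S P by (intro gap_antimono[OF f]) auto
  then have *: "(gap (2 - a) (f (fst t)) (f (fst s)) (f (fst z)) \<and>
        gap b (min (snd t) (snd s)) (max (snd t) (snd s)) (snd z)) \<longleftrightarrow>
      (gap a (fst s) (fst t) (fst z) \<and>
        gap b (min (snd s) (snd t)) (max (snd s) (snd t)) (snd z))"
    if "(a, b) \<in> S" "z \<in> P" for a b z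
    using that by (simp add: min.commute max.commute)
  have "empty_boxes (mirror S) (map_prod f id ` P) (map_prod f id t) (map_prod f id s) \<longleftrightarrow>
    (\<forall>(a, b)\<in>S. \<forall>z\<in>P. \<not> (gap (2 - a) (f (fst t)) (f (fst s)) (f (fst z)) \<and>
        gap b (min (snd t) (snd s)) (max (snd t) (snd s)) (snd z)))"
    by (simp add: empty_boxes_def mirror_def split_beta)
  also have "\<dots> \<longleftrightarrow> empty_boxes S P s t"
    unfolding empty_boxes_def using * by blast
  finally show ?thesis .
qed

text \<open>Reversing the columns exchanges the left and the right point of each pair, so ascending
  pairs become descending and conversely; therefore \<open>x\<close> and \<open>y\<close> change
  places.\<close>

lemma weight_mirror:
  assumes f: "\<And>i j. i \<in> A \<Longrightarrow> j \<in> A \<Longrightarrow> f i < f j \<longleftrightarrow> j < i" and S: "\<forall>(a, b)\<in>S. a \<le> 2"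
    and P: "fst ` P \<subseteq> A"
  shows "weight x y (mirror S) (map_prod f id ` P) = weight y x S P"
proof -
  let ?m = "map_prod f id"
  have inj: "inj_on f A"
    using f by (rule inj_on_antimono)
  have "s = t" if "?m s = ?m t" "s \<in> P" "t \<in> P" for s t
  proof -
    have "fst s \<in> A" "fst t \<in> A" using that(2,3) P by auto
    with that(1) inj show ?thesis by (simp add: inj_on_eq_iff prod_eq_iff)
  qed
  then have inj2: "inj_on (\<lambda>(s, t). (?m t, ?m s)) (P \<times> P)"
    by (auto simp: inj_on_def)
  have less: "fst (?m s) < fst (?m t) \<longleftrightarrow> fst t < fst s" if "s \<in> P" "t \<in> P" for s t
    using that P f[of "fst s" "fst t"] by auto
  have eb: "empty_boxes (mirror S) (?m ` P) (?m t) (?m s) \<longleftrightarrow> empty_boxes S P s t"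
    if "s \<in> P" "t \<in> P" for s t
    using f S P that by (rule empty_boxes_mirror)
  have a: "(?m t, ?m s) \<in> ascs (mirror S) (?m ` P) \<longleftrightarrow> (s, t) \<in> descs S P"
    and d: "(?m t, ?m s) \<in> descs (mirror S) (?m ` P) \<longleftrightarrow> (s, t) \<in> ascs S P"
    if "s \<in> P" "t \<in> P" for s t
    using that less[OF that(2,1)] eb[OF that] imageI[OF that(1), of ?m] imageI[OF that(2), of ?m]
    by (simp_all add: ascs_def descs_def)
  have sub: "ascs Q R \<subseteq> R \<times> R" "descs Q R \<subseteq> R \<times> R" for Q R
    by (auto simp: ascs_def descs_def)
  have im: "X = (\<lambda>(s, t). (?m t, ?m s)) ` Y"
    if X: "X \<subseteq> ?m ` P \<times> ?m ` P" and Y: "Y \<subseteq> P \<times> P"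
      and iff: "\<And>s t. s \<in> P \<Longrightarrow> t \<in> P \<Longrightarrow> (?m t, ?m s) \<in> X \<longleftrightarrow> (s, t) \<in> Y" for X Y
  proof (intro equalityI subsetI)
    fix z assume z: "z \<in> X"
    obtain p q where "z = (p, q)" "p \<in> ?m ` P" "q \<in> ?m ` P"
      using subsetD[OF X z] by (elim SigmaE)
    moreover obtain t where t: "p = ?m t" "t \<in> P" using \<open>p \<in> ?m ` P\<close> by (rule imageE)
    moreover obtain s where s: "q = ?m s" "s \<in> P" using \<open>q \<in> ?m ` P\<close> by (rule imageE)
    ultimately have "z = (?m t, ?m s)" by simp
    moreover have "(s, t) \<in> Y" using iff[OF s(2) t(2)] z \<open>z = (?m t, ?m s)\<close> by (simp only:)
    ultimately show "z \<in> (\<lambda>(s, t). (?m t, ?m s)) ` Y"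
      by (intro image_eqI[of _ _ "(s, t)"]) (simp_all only: prod.case)
  next
    fix z assume "z \<in> (\<lambda>(s, t). (?m t, ?m s)) ` Y"
    then obtain w where w: "w \<in> Y" "z = (\<lambda>(s, t). (?m t, ?m s)) w" by (elim imageE)
    have "fst w \<in> P" "snd w \<in> P" using Y w(1) by auto
    with iff[of "fst w" "snd w"] w show "z \<in> X" by (simp add: split_beta del: map_prod_simp)
  qed
  have "ascs (mirror S) (?m ` P) = (\<lambda>(s, t). (?m t, ?m s)) ` descs S P"
    by (rule im[OF sub(1) sub(2)]) (rule a)
  moreover have "descs (mirror S) (?m ` P) = (\<lambda>(s, t). (?m t, ?m s)) ` ascs S P"
    by (rule im[OF sub(2) sub(1)]) (rule d)
  moreover have "inj_on (\<lambda>(s, t). (?m t, ?m s)) (descs S P)" "inj_on (\<lambda>(s, t). (?m t, ?m s)) (ascs S P)"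
    by (auto intro!: inj_on_subset[OF inj2] simp: descs_def ascs_def)
  ultimately show ?thesis
    by (simp add: weight_def card_image)
qed

text \<open>The exchange of \<open>x\<close> and \<open>y\<close> under reflection is harmless
  because the rising factorial depends only on \<open>x + y\<close>.\<close>

lemma rising_weights_mirror:
  assumes "rising_weights (mirror S)" and S: "\<forall>(a, b)\<in>S. a \<le> 2"
  shows "rising_weights S"
  unfolding rising_weights_def
proof (intro allI impI, elim conjE)
  fix A V :: "nat set" and x y :: "real poly poly"
  assume *: "finite A" "finite V" "card A = card V" "V \<noteq> {}"
  \<comment> \<open>No element of \<open>A\<close> exceeds \<open>Max A\<close>, so the subtraction
    never truncates and reverses the order on \<open>A\<close>.\<close>
  define f where "f = (\<lambda>i. Max A - i)"
  have f: "f i < f j \<longleftrightarrow> j < i" if "i \<in> A" "j \<in> A" for i j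
    using that Max_ge[OF *(1), of i] Max_ge[OF *(1), of j] unfolding f_def by linarith
  have inj: "inj_on f A"
    using f by (rule inj_on_antimono)
  have "(\<Sum>P\<in>diagrams A V. weight x y S P)
     = (\<Sum>P\<in>diagrams A V. weight y x (mirror S) (map_prod f id ` P))"
    by (intro sum.cong refl weight_mirror[OF f S, symmetric]) (auto simp: diagrams_def)
  also have "\<dots> = (\<Sum>P\<in>diagrams (f ` A) V. weight y x (mirror S) P)"
    using inj by (rule sum_diagrams_image[symmetric])
  also have "\<dots> = pochhammer (y + x) (card V - 1)"
    using assms(1) * inj by (simp add: rising_weights_def card_image)
  finally show "(\<Sum>P\<in>diagrams A V. weight x y S P) = pochhammer (x + y) (card V - 1)"
    by (simp add: add.commute)
qed

subsection \<open>Removing the leftmost point\<close>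

text \<open>No pair within the old points sees the new leftmost point, so only pairs starting at it are new.\<close>

lemma weight_insert_leftmost:
  assumes P: "finite P" "\<forall>z\<in>P. c < fst z" and S: "\<forall>(a, b)\<in>S. a = 1 \<or> a = 2"
  shows "weight x y S (insert (c, v) P) =
    x ^ card {t \<in> P. v < snd t \<and> empty_boxes S P (c, v) t} *
    y ^ card {t \<in> P. snd t < v \<and> empty_boxes S P (c, v) t} * weight x y S P"
proof -
  have eb: "empty_boxes S (insert (c, v) P) s t \<longleftrightarrow> empty_boxes S P s t"
    if "s \<in> insert (c, v) P" "t \<in> P" for s t
  proof -
    have "c \<le> fst s" "c < fst t" using that P(2) by auto
    then have "\<not> gap i (fst s) (fst t) c" if "(i, j) \<in> S" for i j
      using that S by (auto simp: gap_def)
    then show ?thesis unfolding empty_boxes_def by fastforce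
  qed
  have notin: "(c, v) \<notin> P" using P(2) by auto
  have a: "ascs S (insert (c, v) P) =
      ascs S P \<union> Pair (c, v) ` {t \<in> P. v < snd t \<and> empty_boxes S P (c, v) t}" (is "_ = _ \<union> Pair (c, v) ` ?N")
  proof (intro equalityI subsetI)
    fix z assume "z \<in> ascs S (insert (c, v) P)"
    then obtain s t where z: "z = (s, t)" "s \<in> insert (c, v) P" "t \<in> insert (c, v) P"
      "fst s < fst t" "snd s < snd t" "empty_boxes S (insert (c, v) P) s t"
      by (auto simp: ascs_def)
    then have "t \<in> P" using P(2) by force
    with z eb[of s t] show "z \<in> ascs S P \<union> Pair (c, v) ` ?N"
      by (cases "s = (c, v)") (auto simp: ascs_def)
  next
    fix z assume "z \<in> ascs S P \<union> Pair (c, v) ` ?N"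
    then show "z \<in> ascs S (insert (c, v) P)"
    proof
      assume "z \<in> ascs S P"
      then show ?thesis using eb by (auto simp: ascs_def)
    next
      assume "z \<in> Pair (c, v) ` ?N"
      then show ?thesis using eb P(2) by (auto simp: ascs_def)
    qed
  qed
  have d: "descs S (insert (c, v) P) =
      descs S P \<union> Pair (c, v) ` {t \<in> P. snd t < v \<and> empty_boxes S P (c, v) t}" (is "_ = _ \<union> Pair (c, v) ` ?N")
  proof (intro equalityI subsetI)
    fix z assume "z \<in> descs S (insert (c, v) P)"
    then obtain s t where z: "z = (s, t)" "s \<in> insert (c, v) P" "t \<in> insert (c, v) P"
      "fst s < fst t" "snd t < snd s" "empty_boxes S (insert (c, v) P) s t"
      by (auto simp: descs_def)
    then have "t \<in> P" using P(2) by force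
    with z eb[of s t] show "z \<in> descs S P \<union> Pair (c, v) ` ?N"
      by (cases "s = (c, v)") (auto simp: descs_def)
  next
    fix z assume "z \<in> descs S P \<union> Pair (c, v) ` ?N"
    then show "z \<in> descs S (insert (c, v) P)"
    proof
      assume "z \<in> descs S P"
      then show ?thesis using eb by (auto simp: descs_def)
    next
      assume "z \<in> Pair (c, v) ` ?N"
      then show ?thesis using eb P(2) by (auto simp: descs_def)
    qed
  qed
  have "card (ascs S (insert (c, v) P)) =
      card (ascs S P) + card {t \<in> P. v < snd t \<and> empty_boxes S P (c, v) t}"
  proof -
    have "Pair (c, v) ` X \<inter> ascs S P = {}" for X using notin by (auto simp: ascs_def)
    then show ?thesis
      unfolding a using P(1) by (subst card_Un_disjoint) (auto simp: finite_ascs card_image inj_on_def)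
  qed
  moreover have "card (descs S (insert (c, v) P)) =
      card (descs S P) + card {t \<in> P. snd t < v \<and> empty_boxes S P (c, v) t}"
  proof -
    have "Pair (c, v) ` X \<inter> descs S P = {}" for X using notin by (auto simp: descs_def)
    then show ?thesis
      unfolding d using P(1) by (subst card_Un_disjoint) (auto simp: finite_descs card_image inj_on_def)
  qed
  ultimately show ?thesis
    by (simp add: weight_def power_add mult_ac)
qed

lemma weight_singleton [simp]: "weight x y S {z} = 1"
proof -
  have "ascs S {z} = {}" "descs S {z} = {}"
    by (auto simp: ascs_def descs_def)
  then show ?thesis by (simp add: weight_def)
qed

text \<open>In the recursion, a new leftmost point at height \<open>\<alpha>\<close> adds an
  ascending pair, one at \<open>\<beta>\<close> a descending pair, and the other \<open>m\<close>
  heights add nothing. The value is the next factor of the rising factorial.\<close>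

lemma sum_two_special:
  fixes x y :: "'a :: comm_ring_1"
  assumes "finite V" "\<alpha> \<in> V" "\<beta> \<in> V" "\<alpha> \<noteq> \<beta>" "card V = Suc (Suc m)"
  shows "(\<Sum>v\<in>V. x ^ (if v = \<alpha> then 1 else 0) * y ^ (if v = \<beta> then 1 else 0)) = x + y + of_nat m"
proof -
  have "card (V - {\<alpha>} - {\<beta>}) = m"
    using assms by simp
  moreover have "(\<Sum>v\<in>V - {\<alpha>} - {\<beta>}. x ^ (if v = \<alpha> then 1 else 0) * y ^ (if v = \<beta> then 1 else 0))
      = (\<Sum>v\<in>V - {\<alpha>} - {\<beta>}. 1)"
    by (rule sum.cong) auto
  ultimately show ?thesis
    using assms by (simp add: sum.remove[of V \<alpha>] sum.remove[of "V - {\<alpha>}" \<beta>])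
qed

lemma Min_less:
  fixes A :: "nat set"
  shows "finite A \<Longrightarrow> a \<in> A \<Longrightarrow> a \<noteq> Min A \<Longrightarrow> Min A < a"
  by (simp add: le_neq_implies_less)

text \<open>Apart from \<open>t\<close>, every point of \<open>P\<close> lies in column 1 or 2 of
  the pair. If both columns are shaded in the same rows, a point blocks the pair by its height
  alone: the arrangement of \<open>P\<close> drops out and only its set of heights matters.\<close>

lemma empty_boxes_leftmost:
  assumes "\<forall>z\<in>P. c < fst z" "inj_on fst P" "inj_on snd P" "t \<in> P"
  shows "empty_boxes ({1, 2} \<times> J) P (c, v) t \<longleftrightarrow>
    (\<forall>w\<in>snd ` P - {snd t}. \<forall>b\<in>J. \<not> gap b (min v (snd t)) (max v (snd t)) w)"
proof -
  have col: "gap 1 c (fst t) (fst z) \<or> gap 2 c (fst t) (fst z) \<longleftrightarrow> snd z \<noteq> snd t" if "z \<in> P" for z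
  proof -
    have "fst z = fst t \<longleftrightarrow> snd z = snd t"
      using that assms(2-4) by (metis inj_on_eq_iff)
    moreover have "c < fst z" using that assms(1) by blast
    ultimately show ?thesis by (auto simp: gap_def)
  qed
  have "empty_boxes ({1, 2} \<times> J) P (c, v) t \<longleftrightarrow>
      (\<forall>z\<in>P. gap 1 c (fst t) (fst z) \<or> gap 2 c (fst t) (fst z) \<longrightarrow>
        (\<forall>b\<in>J. \<not> gap b (min v (snd t)) (max v (snd t)) (snd z)))"
    by (auto simp: empty_boxes_def)
  then show ?thesis using col by auto
qed

text \<open>The hypothesis concerns only sets of heights: one height of the leftmost point starts a
  single ascending pair, one other height a single descending pair. Whatever the rest looks like,
  deleting that point from a diagram with \<open>m + 2\<close> points contributes the factor
  \<open>x + y + m\<close>.\<close>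

lemma rising_weights_leftmost:
  assumes V: "\<And>V. finite V \<Longrightarrow> card V \<ge> 2 \<Longrightarrow> \<exists>\<alpha>\<in>V. \<exists>\<beta>\<in>V. \<alpha> \<noteq> \<beta> \<and> (\<forall>v\<in>V.
      card {u \<in> V. v < u \<and> (\<forall>w\<in>V - {v, u}. \<forall>b\<in>J. \<not> gap b v u w)} = (if v = \<alpha> then 1 else 0) \<and>
      card {u \<in> V. u < v \<and> (\<forall>w\<in>V - {v, u}. \<forall>b\<in>J. \<not> gap b u v w)} = (if v = \<beta> then 1 else 0))"
  shows "rising_weights ({1, 2} \<times> J)"
proof -
  define S where "S = {1, 2 :: nat} \<times> J"
  have S: "\<forall>(a, b)\<in>S. a = 1 \<or> a = 2" by (auto simp: S_def)
  have "(\<Sum>P\<in>diagrams A V. weight x y S P) = pochhammer (x + y) m"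
    if "finite A" "finite V" "card A = Suc m" "card V = Suc m"
    for A V m and x y :: "real poly poly"
    using that
  proof (induction m arbitrary: A V)
    case 0
    then obtain a v where "A = {a}" "V = {v}" by (auto simp: card_Suc_eq)
    then show ?case by (simp add: diagrams_singleton)
  next
    case (Suc m)
    define c where "c = Min A"
    have "A \<noteq> {}" using Suc.prems by auto
    with Suc.prems have c: "c \<in> A" "\<And>a. a \<in> A - {c} \<Longrightarrow> c < a"
      by (simp_all add: c_def Min_less)
    have "2 \<le> card V" using Suc.prems(4) by simp
    from V[OF Suc.prems(2) this] obtain \<alpha> \<beta> where ab: "\<alpha> \<in> V" "\<beta> \<in> V" "\<alpha> \<noteq> \<beta>"
      and cards: "\<forall>v\<in>V.
        card {u \<in> V. v < u \<and> (\<forall>w\<in>V - {v, u}. \<forall>b\<in>J. \<not> gap b v u w)} = (if v = \<alpha> then 1 else 0) \<and>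
        card {u \<in> V. u < v \<and> (\<forall>w\<in>V - {v, u}. \<forall>b\<in>J. \<not> gap b u v w)} = (if v = \<beta> then 1 else 0)"
      by (elim bexE conjE)
    have step: "weight x y S (insert (c, v) P) =
        x ^ (if v = \<alpha> then 1 else 0) * y ^ (if v = \<beta> then 1 else 0) * weight x y S P"
      if v: "v \<in> V" and P: "P \<in> diagrams (A - {c}) (V - {v})" for v P
    proof -
      have P': "inj_on fst P" "inj_on snd P" "fst ` P = A - {c}" "snd ` P = V - {v}"
        using P by (auto simp: diagrams_def)
      have gt: "\<forall>z\<in>P. c < fst z" using P'(3) c(2) by blast
      have fin: "finite P" using diagrams_imp_finite[OF P] Suc.prems by simp
      have eb: "empty_boxes S P (c, v) t \<longleftrightarrow>
          (\<forall>w\<in>V - {v, snd t}. \<forall>b\<in>J. \<not> gap b (min v (snd t)) (max v (snd t)) w)" if "t \<in> P" for t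
      proof -
        have "V - {v} - {snd t} = V - {v, snd t}" by blast
        then show ?thesis
          unfolding S_def empty_boxes_leftmost[OF gt P'(1,2) that] P'(4) by (simp only:)
      qed
      have im: "snd ` {t \<in> P. Q (snd t)} = {u \<in> V - {v}. Q u}" for Q
        using P'(4) by auto
      have cd: "card {t \<in> P. Q (snd t)} = card {u \<in> V - {v}. Q u}" for Q
      proof -
        have "card (snd ` {t \<in> P. Q (snd t)}) = card {t \<in> P. Q (snd t)}"
          by (rule card_image) (rule inj_on_subset[OF P'(2)], blast)
        then show ?thesis by (simp only: im)
      qed
      have "card {t \<in> P. v < snd t \<and> empty_boxes S P (c, v) t} =
          card {t \<in> P. v < snd t \<and> (\<forall>w\<in>V - {v, snd t}. \<forall>b\<in>J. \<not> gap b v (snd t) w)}"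
        by (intro arg_cong[of _ _ card] Collect_cong conj_cong refl)
          (simp add: eb min_absorb1 min_absorb2 max_absorb1 max_absorb2 less_imp_le)
      also have "\<dots> = card {u \<in> V. v < u \<and> (\<forall>w\<in>V - {v, u}. \<forall>b\<in>J. \<not> gap b v u w)}"
        unfolding cd[of "\<lambda>u. v < u \<and> (\<forall>w\<in>V - {v, u}. \<forall>b\<in>J. \<not> gap b v u w)"]
        by (intro arg_cong[of _ _ card]) auto
      also note cards[THEN bspec, OF v, THEN conjunct1]
      finally have 1: "card {t \<in> P. v < snd t \<and> empty_boxes S P (c, v) t} = (if v = \<alpha> then 1 else 0)" .
      have "card {t \<in> P. snd t < v \<and> empty_boxes S P (c, v) t} =
          card {t \<in> P. snd t < v \<and> (\<forall>w\<in>V - {v, snd t}. \<forall>b\<in>J. \<not> gap b (snd t) v w)}"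
        by (intro arg_cong[of _ _ card] Collect_cong conj_cong refl)
          (simp add: eb min_absorb1 min_absorb2 max_absorb1 max_absorb2 less_imp_le)
      also have "\<dots> = card {u \<in> V. u < v \<and> (\<forall>w\<in>V - {v, u}. \<forall>b\<in>J. \<not> gap b u v w)}"
        unfolding cd[of "\<lambda>u. u < v \<and> (\<forall>w\<in>V - {v, u}. \<forall>b\<in>J. \<not> gap b u v w)"]
        by (intro arg_cong[of _ _ card]) auto
      also note cards[THEN bspec, OF v, THEN conjunct2]
      finally have 2: "card {t \<in> P. snd t < v \<and> empty_boxes S P (c, v) t} = (if v = \<beta> then 1 else 0)" .
      show ?thesis
        by (simp only: weight_insert_leftmost[OF fin gt S] 1 2)
    qed
    have "(\<Sum>P\<in>diagrams A V. weight x y S P) =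
        (\<Sum>v\<in>V. \<Sum>P\<in>diagrams (A - {c}) (V - {v}). weight x y S (insert (c, v) P))"
      using Suc.prems c(1) by (intro sum_diagrams_column)
    also have "\<dots> = (\<Sum>v\<in>V. x ^ (if v = \<alpha> then 1 else 0) * y ^ (if v = \<beta> then 1 else 0) *
        (\<Sum>P\<in>diagrams (A - {c}) (V - {v}). weight x y S P))"
      by (simp only: sum_distrib_left step cong: sum.cong)
    also have "\<dots> = (\<Sum>v\<in>V. x ^ (if v = \<alpha> then 1 else 0) * y ^ (if v = \<beta> then 1 else 0) *
        pochhammer (x + y) m)"
    proof (rule sum.cong[OF refl])
      fix v assume v: "v \<in> V"
      have "(\<Sum>P\<in>diagrams (A - {c}) (V - {v}). weight x y S P) = pochhammer (x + y) m"
        by (rule Suc.IH) (use Suc.prems c(1) v in simp_all)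
      then show "x ^ (if v = \<alpha> then 1 else 0) * y ^ (if v = \<beta> then 1 else 0) *
          (\<Sum>P\<in>diagrams (A - {c}) (V - {v}). weight x y S P) =
        x ^ (if v = \<alpha> then 1 else 0) * y ^ (if v = \<beta> then 1 else 0) * pochhammer (x + y) m"
        by (simp only:)
    qed
    also have "\<dots> = (x + y + of_nat m) * pochhammer (x + y) m"
      unfolding sum_distrib_right[symmetric]
      by (simp only: sum_two_special[OF Suc.prems(2) ab Suc.prems(4)])
    finally show ?case
      by (simp add: pochhammer_Suc mult.commute)
  qed
  note * = this
  show ?thesis
    unfolding rising_weights_def S_def[symmetric]
  proof (intro allI impI, elim conjE)
    fix A V :: "nat set" and x y :: "real poly poly"
    assume a: "finite A" "finite V" "card A = card V" "V \<noteq> {}"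
    then have "card V = Suc (card V - 1)" by (simp add: card_gt_0_iff)
    then show "(\<Sum>P\<in>diagrams A V. weight x y S P) = pochhammer (x + y) (card V - 1)"
      using *[of A V "card V - 1" x y] a by simp
  qed
qed

text \<open>With rows 0 and 2 shaded, all other heights must lie between those of the pair, which
  are therefore the minimum and the maximum of \<open>V\<close>. The ascending pair starts at
  \<open>Min V\<close>, the descending one at \<open>Max V\<close>.\<close>

lemma rising_weights_outer_rows: "rising_weights ({1, 2} \<times> {0, 2})"
proof (rule rising_weights_leftmost, goal_cases)
  case (1 V)
  have "V \<noteq> {}" using 1 by auto
  then have mem: "Min V \<in> V" "Max V \<in> V" and bd: "\<And>u. u \<in> V \<Longrightarrow> Min V \<le> u \<and> u \<le> Max V"
    using 1 by auto
  have ne: "Min V \<noteq> Max V"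
  proof
    assume "Min V = Max V"
    then have "V \<subseteq> {Min V}" using bd by force
    then show False using 1 card_mono[of "{Min V}" V] by simp
  qed
  have iff: "(v < u \<and> (\<forall>w\<in>V - {v, u}. \<forall>b\<in>{0, 2}. \<not> gap b v u w)) \<longleftrightarrow> v = Min V \<and> u = Max V"
    if "u \<in> V" "v \<in> V" for u v
  proof
    assume *: "v < u \<and> (\<forall>w\<in>V - {v, u}. \<forall>b\<in>{0, 2}. \<not> gap b v u w)"
    have "w = v \<or> w = u \<or> v < w \<and> w < u" if "w \<in> V" for w
    proof (cases "w = v \<or> w = u")
      case False
      with * that have "\<not> gap 0 v u w" "\<not> gap 2 v u w" by blast+
      with False show ?thesis by (auto simp: gap_def)
    qed blast
    from this[OF mem(1)] this[OF mem(2)] * bd[OF that(1)] bd[OF that(2)] show "v = Min V \<and> u = Max V"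
      by arith
  next
    assume *: "v = Min V \<and> u = Max V"
    then have "v < u" using ne bd[OF that(1)] by simp
    moreover have "v \<le> w \<and> w \<le> u" if "w \<in> V" for w using * bd[OF that] by simp
    ultimately show "v < u \<and> (\<forall>w\<in>V - {v, u}. \<forall>b\<in>{0, 2}. \<not> gap b v u w)"
      by (fastforce simp: gap_def)
  qed
  show ?case
  proof (rule bexI[OF _ mem(1)], rule bexI[OF _ mem(2)], intro conjI ballI ne)
    fix v assume v: "v \<in> V"
    have "{u \<in> V. v < u \<and> (\<forall>w\<in>V - {v, u}. \<forall>b\<in>{0, 2}. \<not> gap b v u w)} =
        (if v = Min V then {Max V} else {})"
      using iff[OF _ v] mem by auto
    then show "card {u \<in> V. v < u \<and> (\<forall>w\<in>V - {v, u}. \<forall>b\<in>{0, 2}. \<not> gap b v u w)} =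
        (if v = Min V then 1 else 0)"
      by simp
    have "{u \<in> V. u < v \<and> (\<forall>w\<in>V - {v, u}. \<forall>b\<in>{0, 2}. \<not> gap b u v w)} =
        (if v = Max V then {Min V} else {})"
      using iff[OF v] mem by (auto simp: insert_commute)
    then show "card {u \<in> V. u < v \<and> (\<forall>w\<in>V - {v, u}. \<forall>b\<in>{0, 2}. \<not> gap b u v w)} =
        (if v = Max V then 1 else 0)"
      by simp
  qed
qed

text \<open>With rows 0 and 1 shaded, all other heights must lie above the pair, so the pair uses
  the smallest height \<open>\<alpha>\<close> and the second smallest
  \<open>\<beta>\<close>.\<close>

lemma rising_weights_lower_rows: "rising_weights ({1, 2} \<times> {0, 1})"
proof (rule rising_weights_leftmost, goal_cases)
  case (1 V)
  define \<alpha> where "\<alpha> = Min V"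
  define \<beta> where "\<beta> = Min (V - {\<alpha>})"
  have "V \<noteq> {}" "V - {\<alpha>} \<noteq> {}"
    using 1 card_mono[of "{\<alpha>}" V] by auto
  then have mem: "\<alpha> \<in> V" "\<beta> \<in> V" "\<alpha> \<noteq> \<beta>"
    and bd: "\<And>u. u \<in> V \<Longrightarrow> \<alpha> \<le> u \<and> (u = \<alpha> \<or> \<beta> \<le> u)"
    using 1 Min_in[of "V - {\<alpha>}"] by (auto simp: \<alpha>_def \<beta>_def)
  have iff: "(v < u \<and> (\<forall>w\<in>V - {v, u}. \<forall>b\<in>{0, 1}. \<not> gap b v u w)) \<longleftrightarrow> v = \<alpha> \<and> u = \<beta>"
    if "u \<in> V" "v \<in> V" for u v
  proof
    assume *: "v < u \<and> (\<forall>w\<in>V - {v, u}. \<forall>b\<in>{0, 1}. \<not> gap b v u w)"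
    have "w = v \<or> w = u \<or> u < w" if "w \<in> V" for w
    proof (cases "w = v \<or> w = u")
      case False
      with * that have "\<not> gap 0 v u w" "\<not> gap 1 v u w" by blast+
      with False show ?thesis by (auto simp: gap_def)
    qed blast
    from this[OF mem(1)] this[OF mem(2)] * bd[OF that(1)] bd[OF that(2)] mem(3) show "v = \<alpha> \<and> u = \<beta>"
      by arith
  next
    assume *: "v = \<alpha> \<and> u = \<beta>"
    then have "v < u" using mem(3) bd[OF mem(2)] by simp
    moreover have "w = v \<or> u \<le> w" if "w \<in> V" for w using * bd[OF that] by auto
    ultimately show "v < u \<and> (\<forall>w\<in>V - {v, u}. \<forall>b\<in>{0, 1}. \<not> gap b v u w)"
      by (fastforce simp: gap_def)
  qed
  show ?case
  proof (rule bexI[OF _ mem(1)], rule bexI[OF _ mem(2)], intro conjI ballI mem(3))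
    fix v assume v: "v \<in> V"
    have "{u \<in> V. v < u \<and> (\<forall>w\<in>V - {v, u}. \<forall>b\<in>{0, 1}. \<not> gap b v u w)} =
        (if v = \<alpha> then {\<beta>} else {})"
      using iff[OF _ v] mem by auto
    then show "card {u \<in> V. v < u \<and> (\<forall>w\<in>V - {v, u}. \<forall>b\<in>{0, 1}. \<not> gap b v u w)} =
        (if v = \<alpha> then 1 else 0)"
      by simp
    have "{u \<in> V. u < v \<and> (\<forall>w\<in>V - {v, u}. \<forall>b\<in>{0, 1}. \<not> gap b u v w)} =
        (if v = \<beta> then {\<alpha>} else {})"
      using iff[OF v] mem by (auto simp: insert_commute)
    then show "card {u \<in> V. u < v \<and> (\<forall>w\<in>V - {v, u}. \<forall>b\<in>{0, 1}. \<not> gap b u v w)} =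
        (if v = \<beta> then 1 else 0)"
      by simp
  qed
qed

subsection \<open>Splitting by the height of the leftmost point\<close>

text \<open>Among the points higher than \<open>v\<close>, these are the right-to-left minima. For
  the shading \<open>(2,1)\<close> they are the partners of a leftmost point at height
  \<open>v\<close> in ascending pairs.\<close>

definition ups :: "nat \<Rightarrow> (nat \<times> nat) set \<Rightarrow> (nat \<times> nat) set" where
  "ups v P = {t \<in> P. v < snd t \<and> (\<forall>z\<in>P. fst t < fst z \<longrightarrow> \<not> (v < snd z \<and> snd z < snd t))}"

text \<open>The counterpart for descending pairs: the right-to-left maxima among the points lower
  than \<open>v\<close>.\<close>

definition downs :: "nat \<Rightarrow> (nat \<times> nat) set \<Rightarrow> (nat \<times> nat) set" where
  "downs v P = {t \<in> P. snd t < v \<and> (\<forall>z\<in>P. fst t < fst z \<longrightarrow> \<not> (snd t < snd z \<and> snd z < v))}"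

text \<open>A new leftmost point is to the right of nothing, so it disqualifies no old point; all of
  \<open>P\<close> is to its right, so it qualifies itself when no height of \<open>P\<close>
  separates it from \<open>v\<close>.\<close>

lemma ups_insert:
  assumes "\<forall>z\<in>P. c < fst z"
  shows "ups v (insert (c, u) P) =
    (if v < u \<and> (\<forall>w\<in>snd ` P. \<not> (v < w \<and> w < u)) then insert (c, u) (ups v P) else ups v P)"
proof -
  have old: "t \<in> ups v (insert (c, u) P) \<longleftrightarrow> t \<in> ups v P" if "t \<in> P" for t
  proof -
    have "\<not> fst t < c" using assms that by (meson less_asym)
    then show ?thesis by (simp add: ups_def that)
  qed
  have "(c, u) \<in> ups v (insert (c, u) P) \<longleftrightarrow> v < u \<and> (\<forall>w\<in>snd ` P. \<not> (v < w \<and> w < u))"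
    using assms by (simp add: ups_def)
  moreover have "(c, u) \<notin> P" using assms by force
  moreover have "ups v (insert (c, u) P) \<subseteq> insert (c, u) P" "ups v P \<subseteq> P"
    by (auto simp: ups_def)
  ultimately show ?thesis
    using old by (simp split: if_split) blast
qed

lemma downs_insert:
  assumes "\<forall>z\<in>P. c < fst z"
  shows "downs v (insert (c, u) P) =
    (if u < v \<and> (\<forall>w\<in>snd ` P. \<not> (u < w \<and> w < v)) then insert (c, u) (downs v P) else downs v P)"
proof -
  have old: "t \<in> downs v (insert (c, u) P) \<longleftrightarrow> t \<in> downs v P" if "t \<in> P" for t
  proof -
    have "\<not> fst t < c" using assms that by (meson less_asym)
    then show ?thesis by (simp add: downs_def that)
  qed
  have "(c, u) \<in> downs v (insert (c, u) P) \<longleftrightarrow> u < v \<and> (\<forall>w\<in>snd ` P. \<not> (u < w \<and> w < v))"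
    using assms by (simp add: downs_def)
  moreover have "(c, u) \<notin> P" using assms by force
  moreover have "downs v (insert (c, u) P) \<subseteq> insert (c, u) P" "downs v P \<subseteq> P"
    by (auto simp: downs_def)
  ultimately show ?thesis
    using old by (simp split: if_split) blast
qed

lemma sum_one_special:
  fixes x :: "'a :: comm_ring_1"
  assumes "finite H" "h \<in> H"
  shows "(\<Sum>u\<in>H. if u = h then x else 1) = x + of_nat (card H - 1)"
proof -
  have "(\<Sum>u\<in>H - {h}. if u = h then x else 1) = (\<Sum>u\<in>H - {h}. 1)"
    by (rule sum.cong) auto
  then show ?thesis
    using assms by (simp add: sum.remove[of H h])
qed

text \<open>Points above and below \<open>v\<close> do not interact. Choosing the columns of the
  lower ones gives the binomial coefficient, and right-to-left minima of \<open>h\<close> points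
  have generating function \<open>pochhammer x h\<close>, as cycles of permutations do. The
  induction deletes the leftmost point.\<close>

lemma sum_ups_downs:
  fixes x y :: "'a :: comm_ring_1"
  assumes "finite A" "finite V" "card A = card V" "v \<notin> V"
  shows "(\<Sum>P\<in>diagrams A V. x ^ card (ups v P) * y ^ card (downs v P)) =
    of_nat (card V choose card {u \<in> V. u < v}) *
      pochhammer x (card {u \<in> V. v < u}) * pochhammer y (card {u \<in> V. u < v})"
  using assms
proof (induction "card V" arbitrary: A V)
  case 0
  then have "A = {}" "V = {}" by auto
  then show ?case by (simp add: ups_def downs_def)
next
  case (Suc n)
  let ?F = "\<lambda>P. x ^ card (ups v P) * y ^ card (downs v P)"
  define L where "L = {u \<in> V. u < v}"
  define H where "H = {u \<in> V. v < u}"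
  have "u < v \<or> v < u" if "u \<in> V" for u
    using Suc.prems(4) that by (metis linorder_neqE_nat)
  then have V: "V = L \<union> H" "L \<inter> H = {}"
    unfolding L_def H_def by auto
  have fin: "finite L" "finite H"
    using Suc.prems(2) unfolding L_def H_def by simp_all
  have cV: "card L + card H = Suc n"
    using Suc.hyps(2) V fin by (simp add: card_Un_disjoint)
  define c where "c = Min A"
  have "A \<noteq> {}" using Suc.prems Suc.hyps by auto
  with Suc.prems have c: "c \<in> A" "\<And>a. a \<in> A - {c} \<Longrightarrow> c < a"
    by (simp_all add: c_def Min_less)
  have gt: "\<forall>z\<in>P. c < fst z" "snd ` P = V - {u}" "(c, u) \<notin> P" "finite P"
    if P: "P \<in> diagrams (A - {c}) (V - {u})" for P u
  proof -
    have fst: "fst ` P = A - {c}" and snd: "snd ` P = V - {u}"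
      using P by (auto simp: diagrams_def)
    show "\<forall>z\<in>P. c < fst z" using fst c(2) by blast
    show "snd ` P = V - {u}" by (fact snd)
    show "(c, u) \<notin> P" using fst by force
    show "finite P" using diagrams_imp_finite[OF P] Suc.prems by simp
  qed
  \<comment> \<open>A leftmost point above \<open>v\<close> belongs to \<open>ups\<close> only at
    the smallest height of \<open>H\<close>; it never affects \<open>downs\<close>.\<close>
  have H: "(\<Sum>P\<in>diagrams (A - {c}) (V - {u}). ?F (insert (c, u) P)) =
      (if u = Min H then x else 1) *
        (of_nat (n choose card L) * pochhammer x (card H - 1) * pochhammer y (card L))"
    if u: "u \<in> H" for u
  proof -
    have uV: "u \<in> V" "v < u" using u by (auto simp: H_def)
    have min: "(\<forall>w\<in>V - {u}. \<not> (v < w \<and> w < u)) \<longleftrightarrow> u = Min H"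
    proof
      assume *: "\<forall>w\<in>V - {u}. \<not> (v < w \<and> w < u)"
      show "u = Min H"
        by (rule Min_eqI[OF fin(2) _ u, symmetric]) (use * in \<open>force simp: H_def\<close>)
    next
      assume *: "u = Min H"
      show "\<forall>w\<in>V - {u}. \<not> (v < w \<and> w < u)"
      proof (intro ballI notI)
        fix w assume "w \<in> V - {u}" "v < w \<and> w < u"
        moreover from this have "w \<in> H" by (simp add: H_def)
        ultimately show False using Min_le[OF fin(2), of w] * by simp
      qed
    qed
    have F: "?F (insert (c, u) P) = (if u = Min H then x else 1) * ?F P"
      if P: "P \<in> diagrams (A - {c}) (V - {u})" for P
    proof -
      have "(c, u) \<notin> ups v P" "finite (ups v P)"
        using gt(3,4)[OF P] by (auto simp: ups_def)
      moreover have "ups v (insert (c, u) P) = (if u = Min H then insert (c, u) (ups v P) else ups v P)"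
        using ups_insert[OF gt(1)[OF P], of v u] uV(2) by (simp only: gt(2)[OF P] min simp_thms)
      moreover have "downs v (insert (c, u) P) = downs v P"
        using downs_insert[OF gt(1)[OF P], of v u] uV(2) by simp
      ultimately show ?thesis by (cases "u = Min H") (simp_all add: mult.assoc)
    qed
    have "card {w \<in> V - {u}. w < v} = card L" "card {w \<in> V - {u}. v < w} = card H - 1"
    proof -
      have "{w \<in> V - {u}. w < v} = L" "{w \<in> V - {u}. v < w} = H - {u}"
        using uV by (auto simp: L_def H_def)
      then show "card {w \<in> V - {u}. w < v} = card L" "card {w \<in> V - {u}. v < w} = card H - 1"
        using u fin by simp_all
    qed
    moreover have n: "n = card (V - {u})"
      using uV(1) Suc.prems(2) by (simp add: Suc.hyps(2)[symmetric])
    moreover have "(\<Sum>P\<in>diagrams (A - {c}) (V - {u}). ?F P) =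
        of_nat (card (V - {u}) choose card {w \<in> V - {u}. w < v}) *
        pochhammer x (card {w \<in> V - {u}. v < w}) * pochhammer y (card {w \<in> V - {u}. w < v})"
      by (rule Suc.hyps(1)[OF n]) (use Suc.prems uV(1) c(1) in simp_all)
    ultimately have "(\<Sum>P\<in>diagrams (A - {c}) (V - {u}). ?F P) =
      of_nat (n choose card L) * pochhammer x (card H - 1) * pochhammer y (card L)"
      by (simp only:)
    then show ?thesis
      by (simp add: F sum_distrib_left[symmetric] cong: sum.cong)
  qed
  have L: "(\<Sum>P\<in>diagrams (A - {c}) (V - {u}). ?F (insert (c, u) P)) =
      (if u = Max L then y else 1) *
        (of_nat (n choose (card L - 1)) * pochhammer x (card H) * pochhammer y (card L - 1))"
    if u: "u \<in> L" for u
  proof -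
    have uV: "u \<in> V" "u < v" using u by (auto simp: L_def)
    have max: "(\<forall>w\<in>V - {u}. \<not> (u < w \<and> w < v)) \<longleftrightarrow> u = Max L"
    proof
      assume *: "\<forall>w\<in>V - {u}. \<not> (u < w \<and> w < v)"
      show "u = Max L"
      proof (rule Max_eqI[OF fin(1) _ u, symmetric])
        fix w assume "w \<in> L"
        then show "w \<le> u"
          using bspec[OF *, of w] by (cases "w = u") (auto simp: L_def)
      qed
    next
      assume *: "u = Max L"
      show "\<forall>w\<in>V - {u}. \<not> (u < w \<and> w < v)"
      proof (intro ballI notI)
        fix w assume "w \<in> V - {u}" "u < w \<and> w < v"
        moreover from this have "w \<in> L" by (simp add: L_def)
        ultimately show False using Max_ge[OF fin(1), of w] * by simp
      qed
    qed
    have F: "?F (insert (c, u) P) = (if u = Max L then y else 1) * ?F P"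
      if P: "P \<in> diagrams (A - {c}) (V - {u})" for P
    proof -
      have "(c, u) \<notin> downs v P" "finite (downs v P)"
        using gt(3,4)[OF P] by (auto simp: downs_def)
      moreover have "downs v (insert (c, u) P) = (if u = Max L then insert (c, u) (downs v P) else downs v P)"
        using downs_insert[OF gt(1)[OF P], of v u] uV(2) by (simp only: gt(2)[OF P] max simp_thms)
      moreover have "ups v (insert (c, u) P) = ups v P"
        using ups_insert[OF gt(1)[OF P], of v u] uV(2) by simp
      ultimately show ?thesis by (cases "u = Max L") (simp_all add: mult_ac)
    qed
    have "card {w \<in> V - {u}. w < v} = card L - 1" "card {w \<in> V - {u}. v < w} = card H"
    proof -
      have "{w \<in> V - {u}. w < v} = L - {u}" "{w \<in> V - {u}. v < w} = H"
        using uV by (auto simp: L_def H_def)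
      then show "card {w \<in> V - {u}. w < v} = card L - 1" "card {w \<in> V - {u}. v < w} = card H"
        using u fin by simp_all
    qed
    moreover have n: "n = card (V - {u})"
      using uV(1) Suc.prems(2) by (simp add: Suc.hyps(2)[symmetric])
    moreover have "(\<Sum>P\<in>diagrams (A - {c}) (V - {u}). ?F P) =
        of_nat (card (V - {u}) choose card {w \<in> V - {u}. w < v}) *
        pochhammer x (card {w \<in> V - {u}. v < w}) * pochhammer y (card {w \<in> V - {u}. w < v})"
      by (rule Suc.hyps(1)[OF n]) (use Suc.prems uV(1) c(1) in simp_all)
    ultimately have "(\<Sum>P\<in>diagrams (A - {c}) (V - {u}). ?F P) =
      of_nat (n choose (card L - 1)) * pochhammer x (card H) * pochhammer y (card L - 1)"
      by (simp only:)
    then show ?thesis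
      by (simp add: F sum_distrib_left[symmetric] cong: sum.cong)
  qed
  have sumH: "(\<Sum>u\<in>H. (if u = Min H then x else 1) *
        (of_nat (n choose card L) * pochhammer x (card H - 1) * pochhammer y (card L))) =
      (if H = {} then 0 else of_nat (n choose card L) * pochhammer x (card H) * pochhammer y (card L))"
  proof (cases "H = {}")
    case False
    then obtain h where h: "card H = Suc h" using fin by (metis card_gt_0_iff gr0_implies_Suc)
    show ?thesis
      unfolding sum_distrib_right[symmetric] sum_one_special[OF fin(2) Min_in[OF fin(2) False]]
      using False h by (simp add: pochhammer_Suc mult_ac)
  qed simp
  \<comment> \<open>For \<open>L = {}\<close> the number \<open>card L - 1\<close> truncates to 0
    and the binomial coefficient would be 1, whereas the sum is empty; hence the separate value
    0.\<close>
  have sumL: "(\<Sum>u\<in>L. (if u = Max L then y else 1) *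
        (of_nat (n choose (card L - 1)) * pochhammer x (card H) * pochhammer y (card L - 1))) =
      (if L = {} then 0 else of_nat (n choose (card L - 1)) * pochhammer x (card H) * pochhammer y (card L))"
  proof (cases "L = {}")
    case False
    then obtain l where l: "card L = Suc l" using fin by (metis card_gt_0_iff gr0_implies_Suc)
    show ?thesis
      unfolding sum_distrib_right[symmetric] sum_one_special[OF fin(1) Max_in[OF fin(1) False]]
      using False l by (simp add: pochhammer_Suc mult_ac)
  qed simp
  have "(\<Sum>P\<in>diagrams A V. ?F P) =
      (\<Sum>u\<in>V. \<Sum>P\<in>diagrams (A - {c}) (V - {u}). ?F (insert (c, u) P))"
    using Suc.prems c(1) by (intro sum_diagrams_column)
  also have "\<dots> = (\<Sum>u\<in>L. \<Sum>P\<in>diagrams (A - {c}) (V - {u}). ?F (insert (c, u) P)) +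
      (\<Sum>u\<in>H. \<Sum>P\<in>diagrams (A - {c}) (V - {u}). ?F (insert (c, u) P))"
    using V(2) fin by (subst (1) V(1)) (rule sum.union_disjoint)
  also have "\<dots> = (if L = {} then 0 else of_nat (n choose (card L - 1)) * pochhammer x (card H) * pochhammer y (card L)) +
      (if H = {} then 0 else of_nat (n choose card L) * pochhammer x (card H) * pochhammer y (card L))"
    unfolding sumL[symmetric] sumH[symmetric] by (simp only: L H cong: sum.cong)
  \<comment> \<open>Pascal's rule: the leftmost point is one of the lower or one of the higher
    points.\<close>
  also have "\<dots> = of_nat (Suc n choose card L) * pochhammer x (card H) * pochhammer y (card L)"
  proof (cases "L = {}")
    case True
    then show ?thesis using cV by auto
  next
    case False
    then obtain l where l: "card L = Suc l" using fin by (metis card_gt_0_iff gr0_implies_Suc)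
    show ?thesis
    proof (cases "H = {}")
      case True
      then show ?thesis using cV l False by simp
    next
      case H: False
      then show ?thesis using False l by (simp add: algebra_simps)
    qed
  qed
  finally show ?case
    unfolding L_def H_def Suc.hyps(2)[symmetric] .
qed

text \<open>In increasing order, the element of \<open>V\<close> with \<open>j\<close> elements
  below it has \<open>card V - 1 - j\<close> above it.\<close>

lemma sum_below_above:
  fixes V :: "nat set"
  assumes "finite V"
  shows "(\<Sum>v\<in>V. g (card {u \<in> V. u < v}) (card {u \<in> V. v < u})) =
    (\<Sum>j<card V. g j (card V - 1 - j) :: 'a :: comm_monoid_add)"
  using assms
proof (induction V arbitrary: g rule: finite_linorder_max_induct)
  case (insert b V)
  have b: "b \<notin> V" using insert.hyps by auto
  have 1: "{u \<in> insert b V. u < v} = {u \<in> V. u < v}" "{u \<in> insert b V. v < u} = insert b {u \<in> V. v < u}"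
    if "v \<in> V" for v
    using that insert.hyps(2) by force+
  have 2: "{u \<in> insert b V. u < b} = V" "{u \<in> insert b V. b < u} = {}"
    using insert.hyps(2) by force+
  have "(\<Sum>v\<in>insert b V. g (card {u \<in> insert b V. u < v}) (card {u \<in> insert b V. v < u})) =
      g (card V) 0 + (\<Sum>v\<in>V. g (card {u \<in> V. u < v}) (Suc (card {u \<in> V. v < u})))"
  proof -
    have "g (card {u \<in> insert b V. u < v}) (card {u \<in> insert b V. v < u}) =
        g (card {u \<in> V. u < v}) (Suc (card {u \<in> V. v < u}))" if "v \<in> V" for v
      unfolding 1[OF that] using insert.hyps(1) b by simp
    then show ?thesis
      unfolding sum.insert[OF insert.hyps(1) b] 2 by simp
  qed
  \<comment> \<open>The new maximum \<open>b\<close> lies above every old element, so the hypothesis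
    is used for \<open>g\<close> shifted by one in its second argument.\<close>
  also have "(\<Sum>v\<in>V. g (card {u \<in> V. u < v}) (Suc (card {u \<in> V. v < u}))) =
      (\<Sum>j<card V. g j (Suc (card V - 1 - j)))"
    by (rule insert.IH[of "\<lambda>i j. g i (Suc j)"])
  also have "\<dots> = (\<Sum>j<card V. g j (card V - j))"
    by (rule sum.cong) (auto simp: Suc_diff_Suc)
  finally show ?case
    using insert.hyps(1) b by (simp add: add.commute)
qed simp

text \<open>Shading all of column 0 forces a pair to start at the leftmost point. The remaining box
  \<open>(2,1)\<close> forbids later points between the two heights, so the partners are exactly the
  points in \<open>ups\<close> and \<open>downs\<close>.\<close>

lemma rising_weights_first_column: "rising_weights {(0,0), (0,1), (0,2), (2,1)}"
  unfolding rising_weights_def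
proof (intro allI impI, elim conjE)
  let ?S = "{(0,0), (0,1), (0,2), (2,1)} :: (nat \<times> nat) set"
  fix A V :: "nat set" and x y :: "real poly poly"
  assume *: "finite A" "finite V" "card A = card V" "V \<noteq> {}"
  define c where "c = Min A"
  have "A \<noteq> {}" using * by auto
  with * have c: "c \<in> A" "\<And>a. a \<in> A - {c} \<Longrightarrow> c < a"
    by (simp_all add: c_def Min_less)
  have weight: "weight x y ?S (insert (c, v) P) = x ^ card (ups v P) * y ^ card (downs v P)"
    if P: "P \<in> diagrams (A - {c}) (V - {v})" for P v
  proof -
    have fst: "fst ` P = A - {c}" and snd: "snd ` P = V - {v}"
      using P by (auto simp: diagrams_def)
    have gt: "c < fst z" if "z \<in> P" for z using fst c(2) that by blast
    have ne: "snd z \<noteq> v" if "z \<in> P" for z using snd that by blast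
    \<comment> \<open>The leftmost point is left of both \<open>s\<close> and \<open>t\<close> and
      differs from them in height, hence lies in one of the three boxes of column 0.\<close>
    have old: "\<not> empty_boxes ?S (insert (c, v) P) s t" if "s \<in> P" "t \<in> P" for s t
    proof -
      have "v \<noteq> snd s" "v \<noteq> snd t" using ne that by blast+
      then have "v < min (snd s) (snd t) \<or> min (snd s) (snd t) < v \<and> v < max (snd s) (snd t) \<or>
          max (snd s) (snd t) < v"
        by arith
      then show ?thesis
        using gt[OF that(1)] by (auto simp: empty_boxes_def gap_def)
    qed
    have new: "empty_boxes ?S (insert (c, v) P) (c, v) t \<longleftrightarrow>
        (\<forall>z\<in>P. fst t < fst z \<longrightarrow> \<not> (min v (snd t) < snd z \<and> snd z < max v (snd t)))" if "t \<in> P" for t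
    proof -
      have "\<not> fst z < c" if "z \<in> P" for z using gt[OF that] by simp
      then show ?thesis
        using gt[OF that] by (auto simp: empty_boxes_def gap_def)
    qed
    have "ascs ?S (insert (c, v) P) = Pair (c, v) ` ups v P"
    proof (intro equalityI subsetI)
      fix z assume "z \<in> ascs ?S (insert (c, v) P)"
      then obtain s t where z: "z = (s, t)" "s \<in> insert (c, v) P" "t \<in> insert (c, v) P"
        "fst s < fst t" "snd s < snd t" "empty_boxes ?S (insert (c, v) P) s t"
        by (auto simp: ascs_def)
      have "c \<le> fst s" using z(2) less_imp_le[OF gt[of s]] by fastforce
      then have "t \<in> P" using z(3,4) by auto
      moreover have "s = (c, v)" using old z \<open>t \<in> P\<close> by blast
      ultimately show "z \<in> Pair (c, v) ` ups v P"
        using z new[of t] by (auto simp: ups_def)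
    next
      fix z assume "z \<in> Pair (c, v) ` ups v P"
      then show "z \<in> ascs ?S (insert (c, v) P)"
        using new gt by (auto simp: ups_def ascs_def)
    qed
    moreover have "descs ?S (insert (c, v) P) = Pair (c, v) ` downs v P"
    proof (intro equalityI subsetI)
      fix z assume "z \<in> descs ?S (insert (c, v) P)"
      then obtain s t where z: "z = (s, t)" "s \<in> insert (c, v) P" "t \<in> insert (c, v) P"
        "fst s < fst t" "snd t < snd s" "empty_boxes ?S (insert (c, v) P) s t"
        by (auto simp: descs_def)
      have "c \<le> fst s" using z(2) less_imp_le[OF gt[of s]] by fastforce
      then have "t \<in> P" using z(3,4) by auto
      moreover have "s = (c, v)" using old z \<open>t \<in> P\<close> by blast
      ultimately show "z \<in> Pair (c, v) ` downs v P"
        using z new[of t] by (auto simp: downs_def)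
    next
      fix z assume "z \<in> Pair (c, v) ` downs v P"
      then show "z \<in> descs ?S (insert (c, v) P)"
        using new gt by (auto simp: downs_def descs_def)
    qed
    ultimately show ?thesis
      by (simp add: weight_def card_image inj_on_def)
  qed
  define g :: "nat \<Rightarrow> nat \<Rightarrow> real poly poly" where
    "g l h = of_nat (card V - 1 choose l) * pochhammer x h * pochhammer y l" for l h
  have "(\<Sum>P\<in>diagrams A V. weight x y ?S P) =
      (\<Sum>v\<in>V. \<Sum>P\<in>diagrams (A - {c}) (V - {v}). weight x y ?S (insert (c, v) P))"
    using * c(1) by (intro sum_diagrams_column)
  also have "\<dots> = (\<Sum>v\<in>V. g (card {u \<in> V. u < v}) (card {u \<in> V. v < u}))"
  proof (rule sum.cong[OF refl])
    fix v assume v: "v \<in> V"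
    have "(\<Sum>P\<in>diagrams (A - {c}) (V - {v}). weight x y ?S (insert (c, v) P)) =
        (\<Sum>P\<in>diagrams (A - {c}) (V - {v}). x ^ card (ups v P) * y ^ card (downs v P))"
      by (rule sum.cong[OF refl]) (rule weight)
    moreover have "{u \<in> V - {v}. u < v} = {u \<in> V. u < v}" "{u \<in> V - {v}. v < u} = {u \<in> V. v < u}"
      by auto
    ultimately show "(\<Sum>P\<in>diagrams (A - {c}) (V - {v}). weight x y ?S (insert (c, v) P)) =
        g (card {u \<in> V. u < v}) (card {u \<in> V. v < u})"
      using sum_ups_downs[of "A - {c}" "V - {v}" v x y] * c(1) v
      by (simp add: g_def)
  qed
  also have "\<dots> = (\<Sum>j<card V. g j (card V - 1 - j))"
    by (rule sum_below_above[OF *(2)])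
  also have "{..<card V} = {..card V - 1}"
    using * by (cases "card V") (auto simp: lessThan_Suc_atMost)
  also have "(\<Sum>j\<le>card V - 1. g j (card V - 1 - j)) = pochhammer (y + x) (card V - 1)"
    unfolding pochhammer_binomial_sum g_def by (simp add: mult_ac)
  finally show "(\<Sum>P\<in>diagrams A V. weight x y ?S P) = pochhammer (x + y) (card V - 1)"
    by (simp add: add.commute)
qed

subsection \<open>Occurrences in permutations\<close>

text \<open>Positions and values are explicit lists instead of sorted sets, so that inverting the
  permutation merely exchanges \<open>ps\<close> and \<open>vs\<close>.\<close>

definition empty_mesh :: "(nat \<times> nat) set \<Rightarrow> (nat \<Rightarrow> nat) \<Rightarrow> nat \<Rightarrow> nat list \<Rightarrow> nat list \<Rightarrow> bool" where
  "empty_mesh R \<pi> n ps vs \<longleftrightarrow> (\<forall>(a, b)\<in>R. \<not> (\<exists>m.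
     (0 # ps @ [n + 1]) ! a < m \<and> m < (0 # ps @ [n + 1]) ! (a + 1) \<and>
     (0 # vs @ [n + 1]) ! b < \<pi> m \<and> \<pi> m < (0 # vs @ [n + 1]) ! (b + 1)))"

lemma card_3_sorted:
  fixes I :: "nat set"
  assumes "card I = 3"
  obtains p q r where "I = {p, q, r}" "p < q" "q < r"
proof -
  have fin: "finite I" using assms by (simp add: card_ge_0_finite)
  have "length (sorted_list_of_set I) = 3" using assms by simp
  moreover have "\<exists>p q r. xs = [p, q, r]" if "length xs = 3" for xs :: "nat list"
    using that by (auto simp: numeral_3_eq_3 length_Suc_conv)
  ultimately obtain p q r where xs: "sorted_list_of_set I = [p, q, r]"
    by blast
  have "I = {p, q, r}"
    using set_sorted_list_of_set[OF fin] unfolding xs by simp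
  moreover have "p < q" "q < r"
    using strict_sorted_list_of_set[of I] unfolding xs by simp_all
  ultimately show thesis by (rule that)
qed

lemma sorted_list_of_set_3:
  "p < q \<Longrightarrow> q < r \<Longrightarrow> sorted_list_of_set {p, q, r :: nat} = [p, q, r]"
  by simp

lemma atLeastAtMost_1_3: "{1..3 :: nat} = {1, 2, 3}"
  by auto

lemma occurrence_123_iff:
  "mesh_occurrence 3 (pattern123 R) n \<pi> I \<longleftrightarrow>
    (\<exists>p q r. I = {p, q, r} \<and> 1 \<le> p \<and> p < q \<and> q < r \<and> r \<le> n \<and> \<pi> p < \<pi> q \<and> \<pi> q < \<pi> r \<and>
       empty_mesh R \<pi> n [p, q, r] [\<pi> p, \<pi> q, \<pi> r])" (is "?L \<longleftrightarrow> ?R")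
proof
  assume L: ?L
  then have "card I = 3" by (simp add: mesh_occurrence_def)
  then obtain p q r where I: "I = {p, q, r}" "p < q" "q < r" by (rule card_3_sorted)
  have sI: "sorted_list_of_set I = [p, q, r]" unfolding I(1) by (rule sorted_list_of_set_3[OF I(2,3)])
  have "\<forall>a\<in>{1..3}. \<forall>b\<in>{1..3}. \<pi> ((0 # [p, q, r] @ [n + 1]) ! a) < \<pi> ((0 # [p, q, r] @ [n + 1]) ! b) \<longleftrightarrow> a < b"
    using L unfolding mesh_occurrence_def pattern123_def Let_def sI by simp
  then have v: "\<pi> p < \<pi> q" "\<pi> q < \<pi> r"
    unfolding atLeastAtMost_1_3 by (simp_all add: numeral_2_eq_2 numeral_3_eq_3)
  have sV: "sorted_list_of_set (\<pi> ` I) = [\<pi> p, \<pi> q, \<pi> r]"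
    unfolding I(1) image_insert image_empty by (rule sorted_list_of_set_3[OF v])
  have "empty_mesh R \<pi> n [p, q, r] [\<pi> p, \<pi> q, \<pi> r]"
    using L unfolding mesh_occurrence_def pattern123_def Let_def sI sV empty_mesh_def by simp
  moreover have "1 \<le> p" "r \<le> n"
    using L unfolding mesh_occurrence_def I(1) by auto
  ultimately show ?R using I v by blast
next
  assume ?R
  then obtain p q r where *: "I = {p, q, r}" "1 \<le> p" "p < q" "q < r" "r \<le> n" "\<pi> p < \<pi> q" "\<pi> q < \<pi> r"
    "empty_mesh R \<pi> n [p, q, r] [\<pi> p, \<pi> q, \<pi> r]" by blast
  have sI: "sorted_list_of_set I = [p, q, r]" unfolding *(1) by (rule sorted_list_of_set_3[OF *(3,4)])
  have sV: "sorted_list_of_set (\<pi> ` I) = [\<pi> p, \<pi> q, \<pi> r]"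
    unfolding *(1) image_insert image_empty by (rule sorted_list_of_set_3[OF *(6,7)])
  have "I \<subseteq> {1..n}" "card I = 3" using * by auto
  moreover have "\<forall>a\<in>{1..3}. \<forall>b\<in>{1..3}. \<pi> ((0 # [p, q, r] @ [n + 1]) ! a) < \<pi> ((0 # [p, q, r] @ [n + 1]) ! b) \<longleftrightarrow> a < b"
    unfolding atLeastAtMost_1_3 using *(6,7) by (simp add: numeral_2_eq_2 numeral_3_eq_3)
  ultimately show ?L
    using *(8) unfolding mesh_occurrence_def pattern123_def Let_def sI sV empty_mesh_def by simp
qed

text \<open>The value list is sorted while the letters at \<open>q\<close> and \<open>r\<close>
  descend, so \<open>\<pi> r\<close> precedes \<open>\<pi> q\<close> in it.\<close>

lemma occurrence_132_iff:
  "mesh_occurrence 3 (pattern132 R) n \<pi> I \<longleftrightarrow>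
    (\<exists>p q r. I = {p, q, r} \<and> 1 \<le> p \<and> p < q \<and> q < r \<and> r \<le> n \<and> \<pi> p < \<pi> r \<and> \<pi> r < \<pi> q \<and>
       empty_mesh R \<pi> n [p, q, r] [\<pi> p, \<pi> r, \<pi> q])" (is "?L \<longleftrightarrow> ?R")
proof
  assume L: ?L
  then have "card I = 3" by (simp add: mesh_occurrence_def)
  then obtain p q r where I: "I = {p, q, r}" "p < q" "q < r" by (rule card_3_sorted)
  have sI: "sorted_list_of_set I = [p, q, r]" unfolding I(1) by (rule sorted_list_of_set_3[OF I(2,3)])
  have "\<forall>a\<in>{1..3}. \<forall>b\<in>{1..3}. \<pi> ((0 # [p, q, r] @ [n + 1]) ! a) < \<pi> ((0 # [p, q, r] @ [n + 1]) ! b) \<longleftrightarrow>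
      transpose 2 3 a < transpose 2 3 b"
    using L unfolding mesh_occurrence_def pattern132_def Let_def sI by simp
  then have v: "\<pi> p < \<pi> r" "\<pi> r < \<pi> q"
    unfolding atLeastAtMost_1_3 by (simp_all add: numeral_2_eq_2 numeral_3_eq_3 transpose_def)
  have sV: "sorted_list_of_set (\<pi> ` I) = [\<pi> p, \<pi> r, \<pi> q]"
    unfolding I(1) image_insert image_empty insert_commute[of "\<pi> q"] by (rule sorted_list_of_set_3[OF v])
  have "empty_mesh R \<pi> n [p, q, r] [\<pi> p, \<pi> r, \<pi> q]"
    using L unfolding mesh_occurrence_def pattern132_def Let_def sI sV empty_mesh_def by simp
  moreover have "1 \<le> p" "r \<le> n"
    using L unfolding mesh_occurrence_def I(1) by auto
  ultimately show ?R using I v by blast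
next
  assume ?R
  then obtain p q r where *: "I = {p, q, r}" "1 \<le> p" "p < q" "q < r" "r \<le> n" "\<pi> p < \<pi> r" "\<pi> r < \<pi> q"
    "empty_mesh R \<pi> n [p, q, r] [\<pi> p, \<pi> r, \<pi> q]" by blast
  have sI: "sorted_list_of_set I = [p, q, r]" unfolding *(1) by (rule sorted_list_of_set_3[OF *(3,4)])
  have sV: "sorted_list_of_set (\<pi> ` I) = [\<pi> p, \<pi> r, \<pi> q]"
    unfolding *(1) image_insert image_empty insert_commute[of "\<pi> q"] by (rule sorted_list_of_set_3[OF *(6,7)])
  have "I \<subseteq> {1..n}" "card I = 3" using * by auto
  moreover have "\<forall>a\<in>{1..3}. \<forall>b\<in>{1..3}. \<pi> ((0 # [p, q, r] @ [n + 1]) ! a) < \<pi> ((0 # [p, q, r] @ [n + 1]) ! b) \<longleftrightarrow>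
      transpose 2 3 a < transpose 2 3 b"
    unfolding atLeastAtMost_1_3 using *(6,7) by (simp add: numeral_2_eq_2 numeral_3_eq_3 transpose_def)
  ultimately show ?L
    using *(8) unfolding mesh_occurrence_def pattern132_def Let_def sI sV empty_mesh_def by simp
qed

section \<open>Inverse permutations and transposed shadings\<close>

lemma empty_mesh_inv:
  assumes "\<pi> permutes {1..n}" "empty_mesh R \<pi> n ps vs"
  shows "empty_mesh (R\<inverse>) (inv \<pi>) n vs ps"
  unfolding empty_mesh_def
proof (intro ballI, clarify)
  fix a b m
  assume "(a, b) \<in> R"
    and *: "(0 # vs @ [n + 1]) ! b < m" "m < (0 # vs @ [n + 1]) ! (b + 1)"
      "(0 # ps @ [n + 1]) ! a < inv \<pi> m" "inv \<pi> m < (0 # ps @ [n + 1]) ! (a + 1)"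
  with assms(2) have "\<not> ((0 # vs @ [n + 1]) ! b < \<pi> (inv \<pi> m) \<and> \<pi> (inv \<pi> m) < (0 # vs @ [n + 1]) ! (b + 1))"
    unfolding empty_mesh_def by blast
  with * show False using permutes_inverses(1)[OF assms(1)] by simp
qed

lemma occurrence_123_inv:
  assumes \<pi>: "\<pi> permutes {1..n}" and "mesh_occurrence 3 (pattern123 R) n \<pi> I"
  shows "mesh_occurrence 3 (pattern123 (R\<inverse>)) n (inv \<pi>) (\<pi> ` I)"
proof -
  obtain p q r where *: "I = {p, q, r}" "1 \<le> p" "p < q" "q < r" "r \<le> n" "\<pi> p < \<pi> q" "\<pi> q < \<pi> r"
    "empty_mesh R \<pi> n [p, q, r] [\<pi> p, \<pi> q, \<pi> r]"
    using assms(2) unfolding occurrence_123_iff by blast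
  have inv: "inv \<pi> (\<pi> i) = i" for i using permutes_inverses(2)[OF \<pi>] .
  have "p \<in> {1..n}" "r \<in> {1..n}" using *(2-5) by auto
  then have bounds: "\<pi> p \<in> {1..n}" "\<pi> r \<in> {1..n}" by (simp_all only: permutes_in_image[OF \<pi>])
  have e: "empty_mesh (R\<inverse>) (inv \<pi>) n [\<pi> p, \<pi> q, \<pi> r] [p, q, r]"
    by (rule empty_mesh_inv[OF \<pi> *(8)])
  show ?thesis
    unfolding occurrence_123_iff
  proof (rule exI[of _ "\<pi> p"], rule exI[of _ "\<pi> q"], rule exI[of _ "\<pi> r"], intro conjI)
    show "\<pi> ` I = {\<pi> p, \<pi> q, \<pi> r}" unfolding *(1) by auto
    show "inv \<pi> (\<pi> p) < inv \<pi> (\<pi> q)" unfolding inv by (fact *(3))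
    show "inv \<pi> (\<pi> q) < inv \<pi> (\<pi> r)" unfolding inv by (fact *(4))
    show "\<pi> p < \<pi> q" "\<pi> q < \<pi> r" by (fact *)+
  qed (use bounds e in \<open>simp_all only: inv atLeastAtMost_iff\<close>)
qed

text \<open>The permutation 132 is its own inverse; the second and the third point of the occurrence
  change places.\<close>

lemma occurrence_132_inv:
  assumes \<pi>: "\<pi> permutes {1..n}" and "mesh_occurrence 3 (pattern132 R) n \<pi> I"
  shows "mesh_occurrence 3 (pattern132 (R\<inverse>)) n (inv \<pi>) (\<pi> ` I)"
proof -
  obtain p q r where *: "I = {p, q, r}" "1 \<le> p" "p < q" "q < r" "r \<le> n" "\<pi> p < \<pi> r" "\<pi> r < \<pi> q"
    "empty_mesh R \<pi> n [p, q, r] [\<pi> p, \<pi> r, \<pi> q]"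
    using assms(2) unfolding occurrence_132_iff by blast
  have inv: "inv \<pi> (\<pi> i) = i" for i using permutes_inverses(2)[OF \<pi>] .
  have "p \<in> {1..n}" "q \<in> {1..n}" using *(2-5) by auto
  then have bounds: "\<pi> p \<in> {1..n}" "\<pi> q \<in> {1..n}" by (simp_all only: permutes_in_image[OF \<pi>])
  have e: "empty_mesh (R\<inverse>) (inv \<pi>) n [\<pi> p, \<pi> r, \<pi> q] [p, q, r]"
    by (rule empty_mesh_inv[OF \<pi> *(8)])
  show ?thesis
    unfolding occurrence_132_iff
  proof (rule exI[of _ "\<pi> p"], rule exI[of _ "\<pi> r"], rule exI[of _ "\<pi> q"], intro conjI)
    show "\<pi> ` I = {\<pi> p, \<pi> r, \<pi> q}" unfolding *(1) by auto
    show "inv \<pi> (\<pi> p) < inv \<pi> (\<pi> q)" unfolding inv by (fact *(3))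
    show "inv \<pi> (\<pi> q) < inv \<pi> (\<pi> r)" unfolding inv by (fact *(4))
    show "\<pi> p < \<pi> r" "\<pi> r < \<pi> q" by (fact *)+
  qed (use bounds e in \<open>simp_all only: inv atLeastAtMost_iff\<close>)
qed

lemma card_occurrences_inv:
  assumes \<pi>: "\<pi> permutes A"
    and "\<And>I. f \<pi> I \<Longrightarrow> g (inv \<pi>) (\<pi> ` I)" "\<And>I. g (inv \<pi>) I \<Longrightarrow> f \<pi> (inv \<pi> ` I)"
  shows "card {I. g (inv \<pi>) I} = card {I. f \<pi> I}"
proof (rule bij_betw_same_card[of "(`) (inv \<pi>)"], rule bij_betw_byWitness[of _ "(`) \<pi>"])
  show "\<forall>I\<in>{I. g (inv \<pi>) I}. \<pi> ` inv \<pi> ` I = I" "\<forall>I\<in>{I. f \<pi> I}. inv \<pi> ` \<pi> ` I = I"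
    using permutes_inverses[OF \<pi>] by (simp_all add: image_image)
qed (use assms(2,3) in auto)

lemma mesh_count_inv:
  assumes \<pi>: "\<pi> permutes {1..n}"
  shows "mesh_count 3 (pattern123 (R\<inverse>)) n (inv \<pi>) = mesh_count 3 (pattern123 R) n \<pi>"
    and "mesh_count 3 (pattern132 (R\<inverse>)) n (inv \<pi>) = mesh_count 3 (pattern132 R) n \<pi>"
  unfolding mesh_count_def
  by (rule card_occurrences_inv[OF \<pi>];
      use occurrence_123_inv[OF \<pi>] occurrence_132_inv[OF \<pi>] occurrence_123_inv[OF permutes_inv[OF \<pi>], of "R\<inverse>"]
        occurrence_132_inv[OF permutes_inv[OF \<pi>], of "R\<inverse>"] permutes_inv_inv[OF \<pi>] in simp)+

lemma joint_number_converse: "joint_number (R\<inverse>) n k l = joint_number R n k l"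
  unfolding joint_number_def
proof (rule bij_betw_same_card[of inv], rule bij_betw_byWitness[of _ inv])
  show "inv ` {\<pi>. \<pi> permutes {1..n} \<and> mesh_count 3 (pattern123 (R\<inverse>)) n \<pi> = k \<and>
      mesh_count 3 (pattern132 (R\<inverse>)) n \<pi> = l}
    \<subseteq> {\<pi>. \<pi> permutes {1..n} \<and> mesh_count 3 (pattern123 R) n \<pi> = k \<and>
      mesh_count 3 (pattern132 R) n \<pi> = l}"
    using mesh_count_inv[where R = "R\<inverse>"] permutes_inv by fastforce
  show "inv ` {\<pi>. \<pi> permutes {1..n} \<and> mesh_count 3 (pattern123 R) n \<pi> = k \<and>
      mesh_count 3 (pattern132 R) n \<pi> = l}
    \<subseteq> {\<pi>. \<pi> permutes {1..n} \<and> mesh_count 3 (pattern123 (R\<inverse>)) n \<pi> = k \<and>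
      mesh_count 3 (pattern132 (R\<inverse>)) n \<pi> = l}"
    using mesh_count_inv permutes_inv by fastforce
qed (use permutes_inv_inv in auto)

text \<open>The list of boundaries starts at the point playing the 1, without the entry 0. Dropping
  that strip is what shifts boxes by \<open>(-1,-1)\<close>.\<close>

lemma between_nth_iff:
  assumes "a \<le> 2" "x < u" "u < w" "w < y"
  shows "[x, u, w, y] ! a < m \<and> m < [x, u, w, y] ! Suc a \<longleftrightarrow> x < m \<and> m < y \<and> gap a u w m"
proof -
  have "a = 0 \<or> a = 1 \<or> a = 2" using assms(1) by auto
  then show ?thesis using assms(2-4) by (auto simp: gap_def)
qed

definition above_first :: "nat \<Rightarrow> (nat \<Rightarrow> nat) \<Rightarrow> (nat \<times> nat) set" where
  "above_first n \<pi> = {(i, \<pi> i) |i. i \<in> {1..n} \<and> \<pi> 1 < \<pi> i}"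

text \<open>The shaded column forces the first letter to play the role of the \<open>1\<close> of the pattern.\<close>

lemma empty_mesh_iff:
  assumes \<pi>: "\<pi> permutes {1..n}" and S: "S \<subseteq> {0..2} \<times> {0..2}"
    and pqr: "1 \<le> p" "p < q" "q < r" "r \<le> n"
    and uw: "{u, w} = {\<pi> q, \<pi> r}" "\<pi> p < u" "u < w"
  shows "empty_mesh (C_boxes \<union> map_prod Suc Suc ` S) \<pi> n [p, q, r] [\<pi> p, u, w] \<longleftrightarrow>
    p = 1 \<and> empty_boxes S (above_first n \<pi>) (q, \<pi> q) (r, \<pi> r)"
proof -
  have range: "\<pi> i \<in> {1..n} \<longleftrightarrow> i \<in> {1..n}" for i using permutes_in_image[OF \<pi>] .
  have inj: "\<pi> i = \<pi> j \<longleftrightarrow> i = j" for i j using permutes_inj[OF \<pi>] by (simp add: inj_eq)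
  have w: "w \<le> n"
  proof -
    have "w = \<pi> q \<or> w = \<pi> r" using uw(1) by (auto simp: doubleton_eq_iff)
    then show ?thesis using range[of q] range[of r] pqr by auto
  qed
  \<comment> \<open>The upper two values in increasing order: \<open>u = \<pi> q\<close> for 123 and
    \<open>u = \<pi> r\<close> for 132, so both patterns are treated at once.\<close>
  have uw': "u = min (\<pi> q) (\<pi> r)" "w = max (\<pi> q) (\<pi> r)"
    using uw(1,3) by (auto simp: doubleton_eq_iff)
  have un: "empty_mesh (A \<union> B) \<pi> n ps vs \<longleftrightarrow> empty_mesh A \<pi> n ps vs \<and> empty_mesh B \<pi> n ps vs" for A B ps vs
    by (auto simp: empty_mesh_def)
  have C: "empty_mesh C_boxes \<pi> n [p, q, r] [\<pi> p, u, w] \<longleftrightarrow> p = 1"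
  proof
    assume e: "empty_mesh C_boxes \<pi> n [p, q, r] [\<pi> p, u, w]"
    show "p = 1"
    proof (rule ccontr)
      assume "p \<noteq> 1"
      with pqr have p: "1 < p" by simp
      \<comment> \<open>The point at position 1 would be left of \<open>p\<close> and differ in
        height from all three letters, so one of the four boxes in \<open>C_boxes\<close> would
        contain it.\<close>
      have "\<pi> 1 \<noteq> \<pi> p" "\<pi> 1 \<noteq> \<pi> q" "\<pi> 1 \<noteq> \<pi> r" using inj pqr p by auto
      then have "\<pi> 1 \<noteq> \<pi> p" "\<pi> 1 \<noteq> u" "\<pi> 1 \<noteq> w" using uw(1) by (auto simp: doubleton_eq_iff)
      moreover have "0 < \<pi> 1" "\<pi> 1 < n + 1" using range[of 1] pqr by auto
      moreover have "\<not> (0 < \<pi> 1 \<and> \<pi> 1 < \<pi> p)" "\<not> (\<pi> p < \<pi> 1 \<and> \<pi> 1 < u)"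
        "\<not> (u < \<pi> 1 \<and> \<pi> 1 < w)" "\<not> (w < \<pi> 1 \<and> \<pi> 1 < n + 1)"
        using e p by (auto simp: empty_mesh_def C_boxes_def numeral_2_eq_2 numeral_3_eq_3)
      ultimately show False by arith
    qed
  qed (auto simp: empty_mesh_def C_boxes_def)
  have mesh: "empty_mesh (map_prod Suc Suc ` S) \<pi> n [1, q, r] [\<pi> 1, u, w] \<longleftrightarrow>
      empty_boxes S (above_first n \<pi>) (q, \<pi> q) (r, \<pi> r)" if p: "p = 1"
  proof -
    \<comment> \<open>Position 1 is not above height \<open>\<pi> 1\<close>, so the outer bounds on
      \<open>m\<close> and \<open>\<pi> m\<close> amount to membership in
      \<open>above_first n \<pi>\<close>; the inner ones are the two \<open>gap\<close>
      conditions.\<close>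
    have cond: "([1, q, r, n + 1] ! a < m \<and> m < [1, q, r, n + 1] ! Suc a \<and>
        [\<pi> 1, u, w, n + 1] ! b < \<pi> m \<and> \<pi> m < [\<pi> 1, u, w, n + 1] ! Suc b) \<longleftrightarrow>
        (m \<in> {1..n} \<and> \<pi> 1 < \<pi> m) \<and> gap a q r m \<and> gap b (min (\<pi> q) (\<pi> r)) (max (\<pi> q) (\<pi> r)) (\<pi> m)"
      if "(a, b) \<in> S" for a b m
    proof -
      have "a \<le> 2" "b \<le> 2" using that S by auto
      then have "([1, q, r, n + 1] ! a < m \<and> m < [1, q, r, n + 1] ! Suc a) \<longleftrightarrow>
            1 < m \<and> m < n + 1 \<and> gap a q r m"
          "([\<pi> 1, u, w, n + 1] ! b < \<pi> m \<and> \<pi> m < [\<pi> 1, u, w, n + 1] ! Suc b) \<longleftrightarrow>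
            \<pi> 1 < \<pi> m \<and> \<pi> m < n + 1 \<and> gap b u w (\<pi> m)"
        using pqr uw p w by (intro between_nth_iff; simp)+
      moreover have "m \<noteq> 1" if "\<pi> 1 < \<pi> m" using that by auto
      ultimately show ?thesis
        using range[of m] unfolding uw'[symmetric] by auto
    qed
    have all: "(\<forall>z\<in>above_first n \<pi>. F z) \<longleftrightarrow> (\<forall>m. m \<in> {1..n} \<and> \<pi> 1 < \<pi> m \<longrightarrow> F (m, \<pi> m))" for F
      unfolding above_first_def by blast
    have "empty_mesh (map_prod Suc Suc ` S) \<pi> n [1, q, r] [\<pi> 1, u, w] \<longleftrightarrow>
        (\<forall>(a, b)\<in>S. \<forall>m. \<not> ([1, q, r, n + 1] ! a < m \<and> m < [1, q, r, n + 1] ! Suc a \<and>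
          [\<pi> 1, u, w, n + 1] ! b < \<pi> m \<and> \<pi> m < [\<pi> 1, u, w, n + 1] ! Suc b))"
      by (simp add: empty_mesh_def split_beta)
    also have "\<dots> \<longleftrightarrow> (\<forall>(a, b)\<in>S. \<forall>m. \<not> ((m \<in> {1..n} \<and> \<pi> 1 < \<pi> m) \<and> gap a q r m \<and>
        gap b (min (\<pi> q) (\<pi> r)) (max (\<pi> q) (\<pi> r)) (\<pi> m)))"
      using cond by (intro ball_cong refl) (auto simp only: prod.case split: prod.split)
    also have "\<dots> \<longleftrightarrow> empty_boxes S (above_first n \<pi>) (q, \<pi> q) (r, \<pi> r)"
      unfolding empty_boxes_def all by (intro ball_cong refl) auto
    finally show ?thesis .
  qed
  then show ?thesis
    unfolding un C using mesh by auto
qed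

subsection \<open>Reduction to diagrams\<close>

text \<open>The first point of an occurrence is at position 1, so its last two points determine it:
  the pair \<open>(s, t)\<close> corresponds to the position set \<open>{1, fst s, fst t}\<close>,
  from which sorting recovers the pair.\<close>

lemma mesh_count_123:
  assumes \<pi>: "\<pi> permutes {1..n}" and S: "S \<subseteq> {0..2} \<times> {0..2}"
  shows "mesh_count 3 (pattern123 (C_boxes \<union> map_prod Suc Suc ` S)) n \<pi> =
    card (ascs S (above_first n \<pi>))"
proof -
  let ?R = "C_boxes \<union> map_prod Suc Suc ` S" and ?Q = "above_first n \<pi>"
  let ?J = "\<lambda>(s, t). {1, fst s, fst t} :: nat set"
  have iff: "empty_mesh ?R \<pi> n [p, q, r] [\<pi> p, \<pi> q, \<pi> r] \<longleftrightarrow>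
      p = 1 \<and> empty_boxes S ?Q (q, \<pi> q) (r, \<pi> r)"
    if "1 \<le> p" "p < q" "q < r" "r \<le> n" "\<pi> p < \<pi> q" "\<pi> q < \<pi> r" for p q r
    using that by (intro empty_mesh_iff[OF \<pi> S]) auto
  have elem: "\<exists>q r. s = (q, \<pi> q) \<and> t = (r, \<pi> r) \<and> 1 < q \<and> q < r \<and> r \<le> n \<and>
      \<pi> 1 < \<pi> q \<and> \<pi> q < \<pi> r \<and> empty_boxes S ?Q s t" if "(s, t) \<in> ascs S ?Q" for s t
  proof -
    have st: "s \<in> ?Q" "t \<in> ?Q" "fst s < fst t" "snd s < snd t" "empty_boxes S ?Q s t"
      using that unfolding ascs_def by simp_all
    obtain q where q: "s = (q, \<pi> q)" "q \<in> {1..n}" "\<pi> 1 < \<pi> q"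
      using st(1) unfolding above_first_def by blast
    obtain r where r: "t = (r, \<pi> r)" "r \<in> {1..n}" "\<pi> 1 < \<pi> r"
      using st(2) unfolding above_first_def by blast
    have "q < r" "\<pi> q < \<pi> r" using st(3,4) q(1) r(1) by simp_all
    moreover have "q \<noteq> 1" using q(3) by auto
    then have "1 < q" using q(2) by simp
    ultimately show ?thesis using q r st(5) by auto
  qed
  have "{I. mesh_occurrence 3 (pattern123 ?R) n \<pi> I} = ?J ` ascs S ?Q"
  proof (intro equalityI subsetI)
    fix I assume "I \<in> {I. mesh_occurrence 3 (pattern123 ?R) n \<pi> I}"
    then obtain p q r where I: "I = {p, q, r}" and
      pqr: "1 \<le> p" "p < q" "q < r" "r \<le> n" "\<pi> p < \<pi> q" "\<pi> q < \<pi> r"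
      and e: "empty_mesh ?R \<pi> n [p, q, r] [\<pi> p, \<pi> q, \<pi> r]"
      unfolding mem_Collect_eq occurrence_123_iff by blast
    from e have p: "p = 1" and eb: "empty_boxes S ?Q (q, \<pi> q) (r, \<pi> r)"
      unfolding iff[OF pqr] by simp_all
    have "(q, \<pi> q) \<in> ?Q" "(r, \<pi> r) \<in> ?Q"
      using pqr p unfolding above_first_def by auto
    then have "((q, \<pi> q), (r, \<pi> r)) \<in> ascs S ?Q"
      using pqr eb unfolding ascs_def by simp
    then show "I \<in> ?J ` ascs S ?Q"
      unfolding I p by (rule rev_image_eqI) simp
  next
    fix I assume "I \<in> ?J ` ascs S ?Q"
    then obtain s t where st: "(s, t) \<in> ascs S ?Q" "I = {1, fst s, fst t}" by auto
    from elem[OF st(1)] obtain q r where qr: "s = (q, \<pi> q)" "t = (r, \<pi> r)" "1 < q" "q < r" "r \<le> n"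
      "\<pi> 1 < \<pi> q" "\<pi> q < \<pi> r" "empty_boxes S ?Q s t" by blast
    have "empty_mesh ?R \<pi> n [1, q, r] [\<pi> 1, \<pi> q, \<pi> r]"
      using qr by (subst iff) simp_all
    moreover have "I = {1, q, r}" unfolding st(2) qr(1,2) by simp
    ultimately have "mesh_occurrence 3 (pattern123 ?R) n \<pi> I"
      unfolding occurrence_123_iff using qr(3-7) by blast
    then show "I \<in> {I. mesh_occurrence 3 (pattern123 ?R) n \<pi> I}" by simp
  qed
  moreover have "inj_on ?J (ascs S ?Q)"
  proof (rule inj_onI, clarify)
    fix s t s' t' assume "(s, t) \<in> ascs S ?Q" "(s', t') \<in> ascs S ?Q"
      and eq: "{1, fst s, fst t} = {1, fst s', fst t'}"
    then obtain q r q' r' where qr: "s = (q, \<pi> q)" "t = (r, \<pi> r)" "1 < q" "q < r"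
      "s' = (q', \<pi> q')" "t' = (r', \<pi> r')" "1 < q'" "q' < r'"
      using elem by meson
    have "[1, q, r] = [1, q', r']"
      using eq sorted_list_of_set_3[OF qr(3,4)] sorted_list_of_set_3[OF qr(7,8)]
      unfolding qr(1,2,5,6) fst_conv by (simp only:)
    then show "s = s' \<and> t = t'" using qr by simp
  qed
  ultimately show ?thesis
    unfolding mesh_count_def by (simp add: card_image)
qed

lemma mesh_count_132:
  assumes \<pi>: "\<pi> permutes {1..n}" and S: "S \<subseteq> {0..2} \<times> {0..2}"
  shows "mesh_count 3 (pattern132 (C_boxes \<union> map_prod Suc Suc ` S)) n \<pi> =
    card (descs S (above_first n \<pi>))"
proof -
  let ?R = "C_boxes \<union> map_prod Suc Suc ` S" and ?Q = "above_first n \<pi>"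
  let ?J = "\<lambda>(s, t). {1, fst s, fst t} :: nat set"
  have iff: "empty_mesh ?R \<pi> n [p, q, r] [\<pi> p, \<pi> r, \<pi> q] \<longleftrightarrow>
      p = 1 \<and> empty_boxes S ?Q (q, \<pi> q) (r, \<pi> r)"
    if "1 \<le> p" "p < q" "q < r" "r \<le> n" "\<pi> p < \<pi> r" "\<pi> r < \<pi> q" for p q r
    using that by (intro empty_mesh_iff[OF \<pi> S]) auto
  have elem: "\<exists>q r. s = (q, \<pi> q) \<and> t = (r, \<pi> r) \<and> 1 < q \<and> q < r \<and> r \<le> n \<and>
      \<pi> 1 < \<pi> r \<and> \<pi> r < \<pi> q \<and> empty_boxes S ?Q s t" if "(s, t) \<in> descs S ?Q" for s t
  proof -
    have st: "s \<in> ?Q" "t \<in> ?Q" "fst s < fst t" "snd t < snd s" "empty_boxes S ?Q s t"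
      using that unfolding descs_def by simp_all
    obtain q where q: "s = (q, \<pi> q)" "q \<in> {1..n}" "\<pi> 1 < \<pi> q"
      using st(1) unfolding above_first_def by blast
    obtain r where r: "t = (r, \<pi> r)" "r \<in> {1..n}" "\<pi> 1 < \<pi> r"
      using st(2) unfolding above_first_def by blast
    have "q < r" "\<pi> r < \<pi> q" using st(3,4) q(1) r(1) by simp_all
    moreover have "q \<noteq> 1" using q(3) by auto
    then have "1 < q" using q(2) by simp
    ultimately show ?thesis using q r st(5) by auto
  qed
  have "{I. mesh_occurrence 3 (pattern132 ?R) n \<pi> I} = ?J ` descs S ?Q"
  proof (intro equalityI subsetI)
    fix I assume "I \<in> {I. mesh_occurrence 3 (pattern132 ?R) n \<pi> I}"
    then obtain p q r where I: "I = {p, q, r}" and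
      pqr: "1 \<le> p" "p < q" "q < r" "r \<le> n" "\<pi> p < \<pi> r" "\<pi> r < \<pi> q"
      and e: "empty_mesh ?R \<pi> n [p, q, r] [\<pi> p, \<pi> r, \<pi> q]"
      unfolding mem_Collect_eq occurrence_132_iff by blast
    from e have p: "p = 1" and eb: "empty_boxes S ?Q (q, \<pi> q) (r, \<pi> r)"
      unfolding iff[OF pqr] by simp_all
    have "(q, \<pi> q) \<in> ?Q" "(r, \<pi> r) \<in> ?Q"
      using pqr p unfolding above_first_def by auto
    then have "((q, \<pi> q), (r, \<pi> r)) \<in> descs S ?Q"
      using pqr eb unfolding descs_def by simp
    then show "I \<in> ?J ` descs S ?Q"
      unfolding I p by (rule rev_image_eqI) simp
  next
    fix I assume "I \<in> ?J ` descs S ?Q"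
    then obtain s t where st: "(s, t) \<in> descs S ?Q" "I = {1, fst s, fst t}" by auto
    from elem[OF st(1)] obtain q r where qr: "s = (q, \<pi> q)" "t = (r, \<pi> r)" "1 < q" "q < r" "r \<le> n"
      "\<pi> 1 < \<pi> r" "\<pi> r < \<pi> q" "empty_boxes S ?Q s t" by blast
    have "empty_mesh ?R \<pi> n [1, q, r] [\<pi> 1, \<pi> r, \<pi> q]"
      using qr by (subst iff) simp_all
    moreover have "I = {1, q, r}" unfolding st(2) qr(1,2) by simp
    ultimately have "mesh_occurrence 3 (pattern132 ?R) n \<pi> I"
      unfolding occurrence_132_iff using qr(3-7) by blast
    then show "I \<in> {I. mesh_occurrence 3 (pattern132 ?R) n \<pi> I}" by simp
  qed
  moreover have "inj_on ?J (descs S ?Q)"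
  proof (rule inj_onI, clarify)
    fix s t s' t' assume "(s, t) \<in> descs S ?Q" "(s', t') \<in> descs S ?Q"
      and eq: "{1, fst s, fst t} = {1, fst s', fst t'}"
    then obtain q r q' r' where qr: "s = (q, \<pi> q)" "t = (r, \<pi> r)" "1 < q" "q < r"
      "s' = (q', \<pi> q')" "t' = (r', \<pi> r')" "1 < q'" "q' < r'"
      using elem by meson
    have "[1, q, r] = [1, q', r']"
      using eq sorted_list_of_set_3[OF qr(3,4)] sorted_list_of_set_3[OF qr(7,8)]
      unfolding qr(1,2,5,6) fst_conv by (simp only:)
    then show "s = s' \<and> t = t'" using qr by simp
  qed
  ultimately show ?thesis
    unfolding mesh_count_def by (simp add: card_image)
qed

text \<open>The graph over \<open>A\<close> determines the permutation, because
  \<open>permutes\<close> fixes everything outside \<open>A\<close>.\<close>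

lemma sum_permutes_diagrams:
  "(\<Sum>\<pi> | \<pi> permutes A. F ((\<lambda>i. (i, \<pi> i)) ` A)) = (\<Sum>P\<in>diagrams A A. F P)"
proof (rule sum.reindex_bij_betw, rule bij_betw_imageI)
  show "inj_on (\<lambda>\<pi>. (\<lambda>i. (i, \<pi> i)) ` A) {\<pi>. \<pi> permutes A}"
  proof (rule inj_onI, rule ext)
    fix \<pi> \<sigma> i
    assume *: "\<pi> \<in> {\<pi>. \<pi> permutes A}" "\<sigma> \<in> {\<pi>. \<pi> permutes A}"
      "(\<lambda>i. (i, \<pi> i)) ` A = (\<lambda>i. (i, \<sigma> i)) ` A"
    show "\<pi> i = \<sigma> i"
    proof (cases "i \<in> A")
      case True
      then have "(i, \<pi> i) \<in> (\<lambda>i. (i, \<sigma> i)) ` A" unfolding *(3)[symmetric] by blast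
      then show ?thesis by auto
    next
      case False
      then show ?thesis using *(1,2) permutes_not_in[of \<pi> A i] permutes_not_in[of \<sigma> A i] by simp
    qed
  qed
  show "(\<lambda>\<pi>. (\<lambda>i. (i, \<pi> i)) ` A) ` {\<pi>. \<pi> permutes A} = diagrams A A"
  proof (intro equalityI subsetI)
    fix P assume "P \<in> (\<lambda>\<pi>. (\<lambda>i. (i, \<pi> i)) ` A) ` {\<pi>. \<pi> permutes A}"
    then obtain \<pi> where \<pi>: "\<pi> permutes A" "P = (\<lambda>i. (i, \<pi> i)) ` A" by blast
    show "P \<in> diagrams A A"
      using permutes_image[OF \<pi>(1)] permutes_inj[OF \<pi>(1)] unfolding diagrams_def \<pi>(2)
      by (auto simp: image_image inj_on_def)
  next
    fix P assume P: "P \<in> diagrams A A"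
    define \<pi> where "\<pi> i = (if i \<in> A then snd (inv_into P fst i) else i)" for i
    have P': "inj_on fst P" "inj_on snd P" "fst ` P = A" "snd ` P = A"
      using P by (auto simp: diagrams_def)
    have *: "\<pi> (fst z) = snd z" if "z \<in> P" for z
      using that P'(1,3) by (auto simp: \<pi>_def inv_into_f_f)
    have "(\<lambda>i. (i, \<pi> i)) ` A = (\<lambda>z. (fst z, \<pi> (fst z))) ` P"
      unfolding P'(3)[symmetric] image_image ..
    also have "\<dots> = (\<lambda>z. z) ` P"
      by (rule image_cong) (simp_all add: *)
    finally have graph: "(\<lambda>i. (i, \<pi> i)) ` A = P" by simp
    have "\<pi> ` A = snd ` P"
      unfolding P'(3)[symmetric] image_image by (rule image_cong) (simp_all add: *)
    then have "\<pi> ` A = A" unfolding P'(4) .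
    moreover have "inj_on \<pi> A"
    proof (rule inj_onI)
      fix i j assume "i \<in> A" "j \<in> A" "\<pi> i = \<pi> j"
      then obtain y z where "y \<in> P" "z \<in> P" "i = fst y" "j = fst z" using P'(3) by blast
      with \<open>\<pi> i = \<pi> j\<close> show "i = j" using P'(2) * by (simp add: inj_on_eq_iff)
    qed
    ultimately have "\<pi> permutes A"
      by (intro bij_imp_permutes) (simp_all add: bij_betw_def \<pi>_def)
    then show "P \<in> (\<lambda>\<pi>. (\<lambda>i. (i, \<pi> i)) ` A) ` {\<pi>. \<pi> permutes A}"
      using graph by blast
  qed
qed

text \<open>Recovering the first letter from the graph makes the weight a function of the diagram
  alone, as \<open>sum_permutes_diagrams\<close> requires.\<close>

lemma above_first_eq:
  assumes "n \<ge> 1"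
  shows "above_first n \<pi> = {z \<in> (\<lambda>i. (i, \<pi> i)) ` {1..n}. \<exists>a. (1, a) \<in> (\<lambda>i. (i, \<pi> i)) ` {1..n} \<and> a < snd z}"
proof -
  have "(1, a) \<in> (\<lambda>i. (i, \<pi> i)) ` {1..n} \<longleftrightarrow> a = \<pi> 1" for a
    using assms by auto
  then show ?thesis by (auto simp: above_first_def)
qed

text \<open>Total weight of the diagrams with \<open>m\<close> points under
  \<open>rising_weights\<close>, extended to the empty diagram. The values at 0 and at 1 are both
  1.\<close>

definition rising_sum :: "real poly poly \<Rightarrow> nat \<Rightarrow> real poly poly" where
  "rising_sum z m = (if m = 0 then 1 else pochhammer z (m - 1))"

text \<open>\<open>B a\<close> collects the permutations with first letter \<open>a\<close>; the
  weight sees only the \<open>n - a\<close> letters above it, and \<open>sum_diagrams_filter\<close>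
  accounts for the others. The factorials stay multiplied out until the coefficients are real
  numbers.\<close>

lemma sum_permutations_weight:
  fixes x y :: "real poly poly"
  assumes S: "rising_weights S" and n: "n \<ge> 1"
  obtains B where "(\<Sum>\<pi> | \<pi> permutes {1..n}. weight x y S (above_first n \<pi>)) = (\<Sum>a\<in>{1..n}. B a)"
    "\<And>a. a \<in> {1..n} \<Longrightarrow> of_nat (fact (n - a)) * B a = of_nat (fact (n - 1)) * rising_sum (x + y) (n - a)"
proof -
  define B where "B a = (\<Sum>P\<in>diagrams ({1..n} - {1}) ({1..<a} \<union> {a<..n}).
      weight x y S {z \<in> P. snd z \<in> {a<..n}})" for a
  have "(\<Sum>\<pi> | \<pi> permutes {1..n}. weight x y S (above_first n \<pi>)) =
      (\<Sum>P\<in>diagrams {1..n} {1..n}. weight x y S {z \<in> P. \<exists>a. (1, a) \<in> P \<and> a < snd z})"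
    unfolding above_first_eq[OF n]
    by (rule sum_permutes_diagrams[where F = "\<lambda>P. weight x y S {z \<in> P. \<exists>a. (1, a) \<in> P \<and> a < snd z}"])
  also have "\<dots> = (\<Sum>a\<in>{1..n}. \<Sum>P\<in>diagrams ({1..n} - {1}) ({1..n} - {a}).
      weight x y S {z \<in> insert (1, a) P. \<exists>b. (1, b) \<in> insert (1, a) P \<and> b < snd z})"
    using n by (intro sum_diagrams_column) auto
  also have "\<dots> = (\<Sum>a\<in>{1..n}. B a)"
  proof (rule sum.cong[OF refl])
    fix a assume a: "a \<in> {1..n}"
    have split: "{1..n} - {a} = {1..<a} \<union> {a<..n}" using a by auto
    show "(\<Sum>P\<in>diagrams ({1..n} - {1}) ({1..n} - {a}).
        weight x y S {z \<in> insert (1, a) P. \<exists>b. (1, b) \<in> insert (1, a) P \<and> b < snd z}) = B a"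
      unfolding B_def split[symmetric]
    proof (rule sum.cong[OF refl], rule arg_cong[where f = "weight x y S"])
      fix P assume "P \<in> diagrams ({1..n} - {1}) ({1..n} - {a})"
      then have sub: "P \<subseteq> ({1..n} - {1}) \<times> ({1..n} - {a})" by (rule diagrams_subset)
      then have "(1, b) \<in> insert (1, a) P \<longleftrightarrow> b = a" for b by auto
      with sub show "{z \<in> insert (1, a) P. \<exists>b. (1, b) \<in> insert (1, a) P \<and> b < snd z} =
          {z \<in> P. snd z \<in> {a<..n}}"
        by auto
    qed
  qed
  finally have 1: "(\<Sum>\<pi> | \<pi> permutes {1..n}. weight x y S (above_first n \<pi>)) = (\<Sum>a\<in>{1..n}. B a)" .
  have 2: "of_nat (fact (n - a)) * B a = of_nat (fact (n - 1)) * rising_sum (x + y) (n - a)"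
    if a: "a \<in> {1..n}" for a
  proof -
    have "of_nat (fact (card {a<..n})) * B a =
        of_nat (fact (card ({1..n} - {1}))) * rising_sum (x + y) (n - a)"
      unfolding B_def
    proof (rule sum_diagrams_filter)
      show "card ({1..n} - {1}) = card {1..<a} + card {a<..n}" using a n by simp
      fix A' :: "nat set" assume A': "finite A'" "card A' = card {a<..n}"
      show "(\<Sum>P\<in>diagrams A' {a<..n}. weight x y S P) = rising_sum (x + y) (n - a)"
      proof (cases "n = a")
        case True
        then have "A' = {}" "{a<..n} = {}" using A' by auto
        then show ?thesis
          using True by (simp add: rising_sum_def weight_def ascs_def descs_def)
      next
        case False
        then have "{a<..n} \<noteq> {}" using a by auto
        then have "(\<Sum>P\<in>diagrams A' {a<..n}. weight x y S P) = pochhammer (x + y) (card {a<..n} - 1)"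
          using S A' unfolding rising_weights_def by blast
        then show ?thesis using False a by (simp add: rising_sum_def)
      qed
    qed auto
    then show ?thesis using n by simp
  qed
  show thesis by (rule that[OF 1 2])
qed

subsection \<open>Coefficients\<close>

definition coeff2 :: "real poly poly \<Rightarrow> nat \<Rightarrow> nat \<Rightarrow> real" where
  "coeff2 p k l = coeff (coeff p k) l"

lemma coeff2_sum: "coeff2 (\<Sum>i\<in>A. f i) k l = (\<Sum>i\<in>A. coeff2 (f i) k l)"
  by (simp add: coeff2_def coeff_sum)

lemma coeff2_of_nat_mult: "coeff2 (of_nat c * p) k l = of_nat c * coeff2 p k l"
  by (simp add: coeff2_def of_nat_poly)

text \<open>\<open>monom 1 1\<close> is the outer variable \<open>x\<close>;
  \<open>[:monom 1 1:]\<close> is the inner variable \<open>y\<close> as a constant polynomial in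
  \<open>x\<close>.\<close>

lemma coeff2_power_mult:
  "coeff2 (monom 1 1 ^ i * [:monom 1 1:] ^ j) k l = (if i = k \<and> j = l then 1 else 0)"
proof -
  have "[:monom 1 1 :: real poly:] ^ j = [:monom 1 j:]"
    by (induction j) (simp_all add: mult_monom flip: one_pCons)
  then show ?thesis
    by (simp add: coeff2_def monom_power mult_monom coeff_monom_mult)
qed

text \<open>Stirling numbers expand the rising factorial into powers of \<open>x + y\<close>. Only
  the exponent \<open>k + l\<close> contributes to \<open>x^k y^l\<close>, with the binomial
  coefficient as its multiplicity.\<close>

lemma coeff2_pochhammer:
  "coeff2 (pochhammer (monom 1 1 + [:monom 1 1:]) m) k l =
    real ((k + l) choose k) * real (stirling m (k + l))"
proof -
  let ?X = "monom 1 1 :: real poly poly" and ?Y = "[:monom 1 1:] :: real poly poly"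
  have "coeff2 ((?X + ?Y) ^ s) k l = (if s = k + l then real ((k + l) choose k) else 0)" for s
  proof -
    have "coeff2 ((?X + ?Y) ^ s) k l =
        (\<Sum>i\<le>s. real (s choose i) * (if i = k \<and> s - i = l then 1 else 0))"
      unfolding binomial_ring coeff2_sum mult.assoc coeff2_of_nat_mult coeff2_power_mult ..
    also have "\<dots> = (\<Sum>i\<in>{..s}. if k = i then (if s = k + l then real (s choose k) else 0) else 0)"
      by (rule sum.cong) auto
    also have "\<dots> = (if s = k + l then real ((k + l) choose k) else 0)"
      by (subst sum.delta') auto
    finally show ?thesis .
  qed
  then have "coeff2 (pochhammer (?X + ?Y) m) k l =
      (\<Sum>s\<le>m. if k + l = s then real (stirling m (k + l)) * real ((k + l) choose k) else 0)"
    unfolding stirling_pochhammer[symmetric] coeff2_sum coeff2_of_nat_mult by (intro sum.cong) auto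
  also have "\<dots> = real ((k + l) choose k) * real (stirling m (k + l))"
    by (subst sum.delta') (auto simp: not_le)
  finally show ?thesis .
qed

definition term_coeff :: "nat \<Rightarrow> nat \<Rightarrow> nat \<Rightarrow> real" where
  "term_coeff m k l = (if m \<le> 1 then (if k = 0 \<and> l = 0 then 1 else 0)
     else real ((k + l) choose k) * real (stirling (m - 1) (k + l)))"

lemma coeff2_rising_sum:
  "coeff2 (rising_sum (monom 1 1 + [:monom 1 1:]) m) k l = term_coeff m k l"
proof -
  have "coeff2 1 k l = (if k = 0 \<and> l = 0 then 1 else 0)"
    using coeff2_power_mult[of 0 0 k l] by auto
  then show ?thesis
    using coeff2_pochhammer[of "m - 1" k l] by (auto simp: rising_sum_def term_coeff_def le_Suc_eq)
qed

text \<open>With the two variables as \<open>x\<close> and \<open>y\<close>, the weight of a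
  permutation is a single monomial, so a coefficient of the sum counts permutations. The index
  \<open>m = n - a\<close> is the number of letters above the first letter \<open>a\<close>.\<close>

lemma joint_number_sum:
  assumes S: "rising_weights S" "S \<subseteq> {0..2} \<times> {0..2}" and n: "n \<ge> 1"
  shows "real (joint_number (C_boxes \<union> map_prod Suc Suc ` S) n k l) =
    (\<Sum>m<n. fact (n - 1) / fact m * term_coeff m k l)"
proof -
  let ?R = "C_boxes \<union> map_prod Suc Suc ` S"
  let ?X = "monom 1 1 :: real poly poly" and ?Y = "[:monom 1 1:] :: real poly poly"
  obtain B where B: "(\<Sum>\<pi> | \<pi> permutes {1..n}. weight ?X ?Y S (above_first n \<pi>)) = (\<Sum>a\<in>{1..n}. B a)"
    "\<And>a. a \<in> {1..n} \<Longrightarrow> of_nat (fact (n - a)) * B a = of_nat (fact (n - 1)) * rising_sum (?X + ?Y) (n - a)"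
    using sum_permutations_weight[OF S(1) n, of ?X ?Y] by blast
  have fin: "finite {\<pi>. \<pi> permutes {1..n}}" by (simp add: finite_permutations)
  have "real (joint_number ?R n k l) = (\<Sum>\<pi> | \<pi> permutes {1..n}.
      if card (ascs S (above_first n \<pi>)) = k \<and> card (descs S (above_first n \<pi>)) = l then 1 else 0)"
  proof -
    have "{\<pi>. \<pi> permutes {1..n} \<and> mesh_count 3 (pattern123 ?R) n \<pi> = k \<and> mesh_count 3 (pattern132 ?R) n \<pi> = l} =
        {\<pi> \<in> {\<pi>. \<pi> permutes {1..n}}. card (ascs S (above_first n \<pi>)) = k \<and> card (descs S (above_first n \<pi>)) = l}"
      using mesh_count_123[OF _ S(2)] mesh_count_132[OF _ S(2)] by auto
    then show ?thesis
      unfolding joint_number_def using fin by (simp add: sum.If_cases Int_def)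
  qed
  also have "\<dots> = coeff2 (\<Sum>\<pi> | \<pi> permutes {1..n}. weight ?X ?Y S (above_first n \<pi>)) k l"
    unfolding weight_def coeff2_sum coeff2_power_mult ..
  also have "\<dots> = (\<Sum>a\<in>{1..n}. fact (n - 1) / fact (n - a) * term_coeff (n - a) k l)"
    unfolding B(1) coeff2_sum
  proof (rule sum.cong[OF refl])
    fix a assume "a \<in> {1..n}"
    then have "coeff2 (of_nat (fact (n - a)) * B a) k l =
        coeff2 (of_nat (fact (n - 1)) * rising_sum (?X + ?Y) (n - a)) k l"
      by (simp only: B(2))
    then have "real (fact (n - a)) * coeff2 (B a) k l = real (fact (n - 1)) * term_coeff (n - a) k l"
      by (simp only: coeff2_of_nat_mult coeff2_rising_sum)
    then show "coeff2 (B a) k l = fact (n - 1) / fact (n - a) * term_coeff (n - a) k l"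
      by (simp add: field_simps)
  qed
  also have "\<dots> = (\<Sum>m<n. fact (n - 1) / fact m * term_coeff m k l)"
    by (rule sum.reindex_bij_witness[of _ "\<lambda>m. n - m" "\<lambda>a. n - a"]) auto
  finally show ?thesis .
qed

text \<open>The empty permutation has no first letter, so the sum over first letters does not cover
  it.\<close>

lemma joint_number_0:
  "joint_number R 0 k l = (if k = 0 \<and> l = 0 then 1 else 0)"
proof -
  have "mesh_count 3 p 0 \<pi> = 0" for p \<pi>
    by (auto simp: mesh_count_def mesh_occurrence_def)
  then have "{\<pi>. \<pi> permutes {1..0} \<and> mesh_count 3 (pattern123 R) 0 \<pi> = k \<and>
      mesh_count 3 (pattern132 R) 0 \<pi> = l} = (if k = 0 \<and> l = 0 then {id} else {})"
    by auto
  then show ?thesis unfolding joint_number_def by simp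
qed

text \<open>Reflection takes number 12 to 11 and 13 to 14; transposition takes 11, 12, 13, 14 and 17
  to 9, 10, 15, 16 and 18.\<close>

lemma shading_rising_weights:
  assumes "j \<in> {9..18}"
  obtains S where "S_boxes j = map_prod Suc Suc ` S" "rising_weights S" "S \<subseteq> {0..2} \<times> {0..2}"
proof -
  \<comment> \<open>fact \<open>rj\<close> concerns \<open>S\<^sub>j\<close> shifted by \<open>(-1,-1)\<close>\<close>
  have r12: "rising_weights {(1,0), (1,2), (2,0), (2,2)}"
    using rising_weights_outer_rows by (simp add: insert_Times_insert insert_commute)
  have r11: "rising_weights {(0,0), (0,2), (1,0), (1,2)}"
    by (rule rising_weights_mirror) (use r12 in \<open>simp_all add: mirror_def insert_commute\<close>)
  have r13: "rising_weights {(0,0), (0,1), (0,2), (2,1)}" by (rule rising_weights_first_column)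
  have r14: "rising_weights {(0,1), (2,0), (2,1), (2,2)}"
    by (rule rising_weights_mirror) (use r13 in \<open>simp_all add: mirror_def insert_commute\<close>)
  have r17: "rising_weights {(1,0), (1,1), (2,0), (2,1)}"
    using rising_weights_lower_rows by (simp add: insert_Times_insert insert_commute)
  have cv: "(insert (a, b) S)\<inverse> = insert (b, a) (S\<inverse>)" for a b :: nat and S by auto
  have r9: "rising_weights {(0,0), (0,1), (2,0), (2,1)}"
    using rising_weights_converse[OF r11] by (simp add: cv insert_commute)
  have r10: "rising_weights {(0,1), (0,2), (2,1), (2,2)}"
    using rising_weights_converse[OF r12] by (simp add: cv insert_commute)
  have r15: "rising_weights {(0,0), (1,0), (1,2), (2,0)}"
    using rising_weights_converse[OF r13] by (simp add: cv insert_commute)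
  have r16: "rising_weights {(0,2), (1,0), (1,2), (2,2)}"
    using rising_weights_converse[OF r14] by (simp add: cv insert_commute)
  have r18: "rising_weights {(0,1), (0,2), (1,1), (1,2)}"
    using rising_weights_converse[OF r17] by (simp add: cv insert_commute)
  have "j = 9 \<or> j = 10 \<or> j = 11 \<or> j = 12 \<or> j = 13 \<or> j = 14 \<or> j = 15 \<or> j = 16 \<or> j = 17 \<or> j = 18"
    using assms unfolding atLeastAtMost_iff by arith
  then show thesis
  proof (elim disjE)
    assume "j = 9"
    then show thesis
      by (intro that[OF _ r9]) (simp_all add: S_boxes_def numeral_2_eq_2 numeral_3_eq_3)
  next
    assume "j = 10"
    then show thesis
      by (intro that[OF _ r10]) (simp_all add: S_boxes_def numeral_2_eq_2 numeral_3_eq_3)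
  next
    assume "j = 11"
    then show thesis
      by (intro that[OF _ r11]) (simp_all add: S_boxes_def numeral_2_eq_2 numeral_3_eq_3)
  next
    assume "j = 12"
    then show thesis
      by (intro that[OF _ r12]) (simp_all add: S_boxes_def numeral_2_eq_2 numeral_3_eq_3)
  next
    assume "j = 13"
    then show thesis
      by (intro that[OF _ r13]) (simp_all add: S_boxes_def numeral_2_eq_2 numeral_3_eq_3)
  next
    assume "j = 14"
    then show thesis
      by (intro that[OF _ r14]) (simp_all add: S_boxes_def numeral_2_eq_2 numeral_3_eq_3)
  next
    assume "j = 15"
    then show thesis
      by (intro that[OF _ r15]) (simp_all add: S_boxes_def numeral_2_eq_2 numeral_3_eq_3)
  next
    assume "j = 16"
    then show thesis
      by (intro that[OF _ r16]) (simp_all add: S_boxes_def numeral_2_eq_2 numeral_3_eq_3)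
  next
    assume "j = 17"
    then show thesis
      by (intro that[OF _ r17]) (simp_all add: S_boxes_def numeral_2_eq_2 numeral_3_eq_3)
  next
    assume "j = 18"
    then show thesis
      by (intro that[OF _ r18]) (simp_all add: S_boxes_def numeral_2_eq_2 numeral_3_eq_3)
  qed
qed

lemma joint_number_shadings:
  assumes "R \<in> shadings" "n \<ge> 1"
  shows "real (joint_number R n k l) = (\<Sum>m<n. fact (n - 1) / fact m * term_coeff m k l)"
proof -
  have X: "real (joint_number (X_boxes j) n k l) = (\<Sum>m<n. fact (n - 1) / fact m * term_coeff m k l)"
    if j: "j \<in> {9..18}" for j
  proof -
    obtain S where "S_boxes j = map_prod Suc Suc ` S" "rising_weights S" "S \<subseteq> {0..2} \<times> {0..2}"
      using shading_rising_weights[OF j] by blast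
    then show ?thesis
      using joint_number_sum[of S n k l] assms(2) by (simp only: X_boxes_def)
  qed
  have Y: "Y_boxes j = (X_boxes j)\<inverse>" for j
    by (auto simp: Y_boxes_def)
  from assms(1) obtain j where "j \<in> {9..18}" "R = X_boxes j \<or> R = Y_boxes j"
    unfolding shadings_def by blast
  with X[of j] show ?thesis
    by (auto simp: Y joint_number_converse)
qed

text \<open>The terms \<open>m = 0\<close> and \<open>m = 1\<close> give \<open>(n - 1)!\<close>
  each, but only for \<open>k = l = 0\<close>; there all later terms vanish because
  \<open>stirling (i - 1) 0 = 0\<close> for \<open>i \<ge> 2\<close>.\<close>

lemma joint_number_formula:
  assumes R: "R \<in> shadings" and n: "n \<ge> 2"
  shows "real (joint_number R n k l) =
    (if k \<noteq> 0 \<or> l \<noteq> 0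
     then fact (n - 1) * real ((k + l) choose k) *
          (\<Sum>i=2..n-1. 1 / fact i * real (stirling (i - 1) (k + l)))
     else 2 * fact (n - 1))"
proof -
  have set: "{..<n} = insert 0 (insert 1 {2..n-1})" using n by auto
  have "real (joint_number R n k l) = (\<Sum>m<n. fact (n - 1) / fact m * term_coeff m k l)"
    using joint_number_shadings[OF R] n by simp
  also have "\<dots> = fact (n - 1) * term_coeff 0 k l + fact (n - 1) * term_coeff 1 k l +
      (\<Sum>m=2..n-1. fact (n - 1) / fact m * term_coeff m k l)"
    unfolding set by simp
  also have "(\<Sum>m=2..n-1. fact (n - 1) / fact m * term_coeff m k l) =
      (\<Sum>i=2..n-1. fact (n - 1) * real ((k + l) choose k) * (1 / fact i * real (stirling (i - 1) (k + l))))"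
    by (rule sum.cong) (auto simp: term_coeff_def)
  also have "\<dots> = fact (n - 1) * real ((k + l) choose k) *
      (\<Sum>i=2..n-1. 1 / fact i * real (stirling (i - 1) (k + l)))"
    by (rule sum_distrib_left[symmetric])
  also have "\<dots> = (if k \<noteq> 0 \<or> l \<noteq> 0 then fact (n - 1) * real ((k + l) choose k) *
      (\<Sum>i=2..n-1. 1 / fact i * real (stirling (i - 1) (k + l))) else 0)"
  proof (cases "k = 0 \<and> l = 0")
    case True
    have "stirling (i - 1) 0 = 0" if "i \<in> {2..n-1}" for i
      using that by (cases "i - 1") auto
    with True show ?thesis by simp
  qed auto
  finally show ?thesis
    by (simp add: term_coeff_def)
qed

section \<open>The bivariate generating function\<close>

lemma coeff2_monom: "coeff2 (monom (monom c l) k) k' l' = (if k = k' \<and> l = l' then c else 0)"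
  by (simp add: coeff2_def)

lemma coeff2_sum_monom:
  "coeff2 (\<Sum>k=0..M. \<Sum>l=0..N. monom (monom (f k l) l) k) k' l' = (if k' \<le> M \<and> l' \<le> N then f k' l' else 0)"
proof -
  have "coeff2 (\<Sum>k=0..M. \<Sum>l=0..N. monom (monom (f k l) l) k) k' l' =
      (\<Sum>k=0..M. if k' = k then (\<Sum>l=0..N. if l' = l then f k l else 0) else 0)"
    unfolding coeff2_sum coeff2_monom by (intro sum.cong) auto
  then show ?thesis by simp
qed

lemma poly_poly_eqI: "(\<And>k l. coeff2 p k l = coeff2 q k l) \<Longrightarrow> p = q"
  by (intro poly_eqI) (simp add: coeff2_def)

text \<open>The exponents in \<open>joint_gf\<close> stop at \<open>n - 2\<close>, those on the
  right at \<open>n - 1\<close>. The extra terms are 0: \<open>i - 1\<close> is at most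
  \<open>n - 2\<close>, so the Stirling number vanishes once \<open>k + l\<close> exceeds
  \<open>n - 2\<close>.\<close>

lemma joint_gf_formula:
  assumes R: "R \<in> shadings" and n: "n \<ge> 2"
  shows "joint_gf R n =
        smult [:fact (n - 1):]
          (\<Sum>k=0..n-1. \<Sum>l=0..n-1. \<Sum>i=2..n-1.
            monom (monom (1 / fact i * real ((k + l) choose k) * real (stirling (i - 1) (k + l))) l) k)
        + [:[:2 * fact (n - 1):]:]"
proof (rule poly_poly_eqI)
  fix k l
  define f where "f k l = (\<Sum>i=2..n-1. 1 / fact i * real ((k + l) choose k) * real (stirling (i - 1) (k + l)))" for k l
  have f: "f k l = 0" if "n - 2 < k + l" for k l
  proof -
    have "stirling (i - 1) (k + l) = 0" if "i \<in> {2..n-1}" for i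
      using that \<open>n - 2 < k + l\<close> by (intro stirling_less) auto
    then show ?thesis by (simp add: f_def)
  qed
  \<comment> \<open>The triple sum also has a term for \<open>k = l = 0\<close>; as it is 0, the
    constant coefficient is the added \<open>2 * fact (n - 1)\<close> alone.\<close>
  have f0: "f 0 0 = 0"
  proof -
    have "stirling (i - 1) 0 = 0" if "i \<in> {2..n-1}" for i
      using that by (cases "i - 1") auto
    then show ?thesis by (simp add: f_def)
  qed
  have T: "real (joint_number R n k l) = fact (n - 1) * f k l + (if k = 0 \<and> l = 0 then 2 * fact (n - 1) else 0)" for k l
    using f0 unfolding joint_number_formula[OF R n]
    by (auto simp: f_def sum_distrib_left mult_ac intro!: sum.cong)
  have lin: "coeff2 (smult [:c:] p + [:[:d:]:]) k l = c * coeff2 p k l + (if k = 0 \<and> l = 0 then d else 0)" for c d p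
    by (auto simp: coeff2_def coeff_pCons split: nat.split)
  have inner: "(\<Sum>i=2..n-1. monom (monom (1 / fact i * real ((k + l) choose k) * real (stirling (i - 1) (k + l))) l) k)
      = monom (monom (f k l) l) k" for k l
  proof (rule poly_poly_eqI)
    fix k' l'
    show "coeff2 (\<Sum>i=2..n-1. monom (monom (1 / fact i * real ((k + l) choose k) *
        real (stirling (i - 1) (k + l))) l) k) k' l' = coeff2 (monom (monom (f k l) l) k) k' l'"
      unfolding coeff2_sum coeff2_monom f_def by (cases "k = k'"; cases "l = l'") simp_all
  qed
  show "coeff2 (joint_gf R n) k l = coeff2 (smult [:fact (n - 1):]
          (\<Sum>k=0..n-1. \<Sum>l=0..n-1. \<Sum>i=2..n-1.
            monom (monom (1 / fact i * real ((k + l) choose k) * real (stirling (i - 1) (k + l))) l) k)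
        + [:[:2 * fact (n - 1):]:]) k l"
    unfolding joint_gf_def inner lin coeff2_sum_monom T using f[of k l] n by auto
qed

theorem theorem2p4:
  shows "(\<forall>R\<in>shadings. \<forall>R'\<in>shadings. same_joint_distribution R R') \<and>
    (\<forall>R\<in>shadings. \<forall>n\<ge>2.
      (\<forall>k l. real (joint_number R n k l) =
        (if k \<noteq> 0 \<or> l \<noteq> 0
         then fact (n - 1) * real ((k + l) choose k) *
              (\<Sum>i=2..n-1. 1 / fact i * real (stirling (i - 1) (k + l)))
         else 2 * fact (n - 1))) \<and>
      joint_gf R n =
        smult [:fact (n - 1):]
          (\<Sum>k=0..n-1. \<Sum>l=0..n-1. \<Sum>i=2..n-1.
            monom (monom (1 / fact i * real ((k + l) choose k) * real (stirling (i - 1) (k + l))) l) k)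
        + [:[:2 * fact (n - 1):]:])"
proof (intro conjI ballI allI impI)
  fix R R' assume R: "R \<in> shadings" "R' \<in> shadings"
  show "same_joint_distribution R R'"
    unfolding same_joint_distribution_def
  proof (intro allI)
    fix n k l
    show "joint_number R n k l = joint_number R' n k l"
    proof (cases "n = 0")
      case True
      then show ?thesis by (simp only: joint_number_0)
    next
      case False
      then have "real (joint_number R n k l) = real (joint_number R' n k l)"
        using joint_number_shadings[OF R(1), of n k l] joint_number_shadings[OF R(2), of n k l] by simp
      then show ?thesis by simp
    qed
  qed
qed (fact joint_number_formula joint_gf_formula)+

end
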